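(* Let $I\subset\mathbb{R}$ be an open interval and let $N_0:I\to H^2$, $N_1:I\to S^2_1$ be real-analytic maps satisfying $\langle N_1(t),N_0(t)\rangle=0$ for all $t\in I$ and $\langle N_1(t),N_0'(t)-N_1(t)\rangle\not\equiv 0$ on $I$. Then there exists a Lorentz harmonic map $\nu:I\times I\to H^2$, $(x,y)\mapsto\nu(x,y)$, with $(x,y)$ null coordinates, such that $\nu(t,t)=N_0(t)$ and $\nu_x(t,t)=N_1(t)$ for all $t\in I$.
   Context: $\mathfrak{sl}(2,\mathbb{R})$ is the space of real traceless $2\times2$ matrices with the Lorentzian inner product $\langle X,Y\rangle$ determined by $\langle X,X\rangle=-\det X$ (so $\mathfrak{sl}(2,\mathbb{R})\cong\mathbb{R}^{2,1}$). $H^2=\{X\in\mathfrak{sl}(2,\mathbb{R}):\langle X,X\rangle=-1\}$ and $S^2_1=\{X\in\mathfrak{sl}(2,\mathbb{R}):\langle X,X\rangle=1\}$. $I\times I$ carries the Lorentzian metric $dx\,dy$ (null coordinates $(x,y)$). A smooth map $\nu:I\times I\to H^2$ is Lorentz harmonic iff $\nu_{xy}$ is pointwise parallel to $\nu$. *)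

theory Defs
  imports "HOL-Analysis.Analysis"
begin

definition sl2 :: "(real^2^2) set" where
  "sl2 = {X. trace X = 0}"

text \<open>Lorentzian inner product: polarization of the quadratic form <X,X> = - det X.\<close>
definition lor :: "real^2^2 \<Rightarrow> real^2^2 \<Rightarrow> real" where
  "lor X Y = (det X + det Y - det (X + Y)) / 2"

definition H2 :: "(real^2^2) set" where
  "H2 = {X \<in> sl2. lor X X = -1}"

definition S21 :: "(real^2^2) set" where
  "S21 = {X \<in> sl2. lor X X = 1}"

definition real_analytic_on :: "(real \<Rightarrow> 'a::real_normed_vector) \<Rightarrow> real set \<Rightarrow> bool" where
  "real_analytic_on f S \<longleftrightarrow>
     (\<forall>t0\<in>S. \<exists>r>0. \<exists>c::nat \<Rightarrow> 'a.
        \<forall>t. \<bar>t - t0\<bar> < r \<longrightarrow> (\<lambda>n. ((t - t0) ^ n) *\<^sub>R c n) sums f t)"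

definition Dx :: "(real \<times> real \<Rightarrow> 'a::real_normed_vector) \<Rightarrow> real \<times> real \<Rightarrow> 'a" where
  "Dx f p = vector_derivative (\<lambda>s. f (s, snd p)) (at (fst p))"

definition Dy :: "(real \<times> real \<Rightarrow> 'a::real_normed_vector) \<Rightarrow> real \<times> real \<Rightarrow> 'a" where
  "Dy f p = vector_derivative (\<lambda>s. f (fst p, s)) (at (snd p))"

fun Dpart :: "bool list \<Rightarrow> (real \<times> real \<Rightarrow> 'a::real_normed_vector) \<Rightarrow> real \<times> real \<Rightarrow> 'a" where
  "Dpart [] f = f"
| "Dpart (b # bs) f = Dpart bs (if b then Dx f else Dy f)"

definition smooth2_on :: "(real \<times> real) set \<Rightarrow> (real \<times> real \<Rightarrow> 'a::real_normed_vector) \<Rightarrow> bool" where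
  "smooth2_on S f \<longleftrightarrow>
     (\<forall>bs. continuous_on S (Dpart bs f) \<and>
        (\<forall>p\<in>S. (\<lambda>s. Dpart bs f (s, snd p)) differentiable (at (fst p)) \<and>
               (\<lambda>s. Dpart bs f (fst p, s)) differentiable (at (snd p))))"

text \<open>Lorentz harmonic map into H^2 (metric dx dy): smooth, values in H^2,
  and nu_xy pointwise parallel to nu.\<close>
definition lorentz_harmonic :: "(real \<times> real) set \<Rightarrow> (real \<times> real \<Rightarrow> real^2^2) \<Rightarrow> bool" where
  "lorentz_harmonic S \<nu> \<longleftrightarrow>
     smooth2_on S \<nu> \<and> (\<forall>p\<in>S. \<nu> p \<in> H2) \<and>
     (\<forall>p\<in>S. \<exists>c::real. Dy (Dx \<nu>) p = c *\<^sub>R \<nu> p)"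

end

(* A map nu into H^2 with |nu_x| = 1 has the orthonormal frame (nu, e, f) with e = nu_x, and harmonicity
   makes its structure equations
     nu_x = e,         e_x = nu + k f,  f_x = - k e,
     nu_y = c e + d f, e_y = c nu,      f_y = d nu,
   with c_x = k d, d_x = - k c, k_y = - d.  Hence c + i d = (c0 + i d0)(y) exp(- i phi) with phi_x = k,
   and phi solves the sine-Gordon type equation phi_xy = c0(y) sin phi - d0(y) cos phi with phi = 0 and
   phi_x = k0 on the diagonal.  The right-hand side is globally Lipschitz in phi, so Picard iteration
   gives a solution on all of I x I.  Once c is known, every entry of nu solves the linear equation
   u_xy = c u.  The frame equations follow by uniqueness, and they make the dual tensor
   - nu nu^T + e e^T + f f^T constant in x, so that the frame stays orthonormal and nu stays in H^2. *)

theory Submission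
  imports Defs
begin

section \<open>Functions of two variables with continuous partial derivatives\<close>

text \<open>The obstacle is existence on the whole square and not only near the diagonal. The
  harmonic map equation and the system for c, d, k are nonlinear without a global Lipschitz bound,
  so Picard iteration applied to them directly gives no control far from the diagonal. But c_x = k
  d, d_x = - k c rotates (c, d) in x with angular speed - k, so its length depends on y alone; the
  angle phi absorbs this motion and leaves only sine and cosine of the unknown. The equations for c,
  d, k are the compatibility conditions e_xy = e_yx and f_xy = f_yx. The ansatz |nu_x| = 1 is
  consistent: it holds on the diagonal because N1 takes values in S21, and it propagates since <e,
  e>_y = 2 c <nu, e> = 0. The diagonal is transversal to both null directions, so u and u_x on it
  also fix u_y, through d/dt u(t, t) = u_x + u_y. The same chain rule gives N0' = e + (c e + d f),
  which is where the factors 1 + c in the initial data come from.\<close>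

definition grad_on :: "(real \<times> real) set \<Rightarrow> (real \<times> real \<Rightarrow> 'a::real_normed_vector) \<Rightarrow>
    (real \<times> real \<Rightarrow> 'a) \<Rightarrow> (real \<times> real \<Rightarrow> 'a) \<Rightarrow> bool" where
  "grad_on S f fx fy \<longleftrightarrow>
     (\<forall>p\<in>S. (f has_derivative (\<lambda>h. fst h *\<^sub>R fx p + snd h *\<^sub>R fy p)) (at p))"

lemma grad_onI:
  assumes "\<And>p. p \<in> S \<Longrightarrow> (f has_derivative (\<lambda>h. fst h *\<^sub>R fx p + snd h *\<^sub>R fy p)) (at p)"
  shows "grad_on S f fx fy"
  using assms by (simp add: grad_on_def)

lemma grad_onD:
  assumes "grad_on S f fx fy" and "p \<in> S"
  shows "(f has_derivative (\<lambda>h. fst h *\<^sub>R fx p + snd h *\<^sub>R fy p)) (at p)"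
  using assms by (simp add: grad_on_def)

text \<open>Partials are existentially quantified instead of being computed by \<open>Dx\<close> and
  \<open>Dy\<close>, so each closure rule can supply its own formula for them.
  \<open>grad_on\<close> asks for the total derivative, so that the chain rule applies to
  substitutions such as (x, y) to (x, x) or (y, x).\<close>

primrec Ck :: "nat \<Rightarrow> (real \<times> real) set \<Rightarrow> (real \<times> real \<Rightarrow> 'a::real_normed_vector) \<Rightarrow> bool" where
  "Ck 0 S f \<longleftrightarrow> continuous_on S f"
| "Ck (Suc n) S f \<longleftrightarrow> (\<exists>fx fy. grad_on S f fx fy \<and> Ck n S fx \<and> Ck n S fy)"

definition Cinf :: "(real \<times> real) set \<Rightarrow> (real \<times> real \<Rightarrow> 'a::real_normed_vector) \<Rightarrow> bool" where
  "Cinf S f \<longleftrightarrow> (\<forall>n. Ck n S f)"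

lemma grad_on_continuous: "grad_on S f fx fy \<Longrightarrow> continuous_on S f"
  unfolding grad_on_def by (meson continuous_at_imp_continuous_on has_derivative_continuous)

lemma grad_on_cong:
  assumes "open S" and "grad_on S f fx fy"
    and "\<And>p. p \<in> S \<Longrightarrow> f p = g p" "\<And>p. p \<in> S \<Longrightarrow> fx p = gx p" "\<And>p. p \<in> S \<Longrightarrow> fy p = gy p"
  shows "grad_on S g gx gy"
  unfolding grad_on_def
proof
  fix p assume p: "p \<in> S"
  have "(f has_derivative (\<lambda>h. fst h *\<^sub>R fx p + snd h *\<^sub>R fy p)) (at p)"
    using assms(2) p by (auto simp: grad_on_def)
  then have "(g has_derivative (\<lambda>h. fst h *\<^sub>R fx p + snd h *\<^sub>R fy p)) (at p)"
    by (rule has_derivative_transform_within_open[OF _ assms(1) p assms(3)])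
  then show "(g has_derivative (\<lambda>h. fst h *\<^sub>R gx p + snd h *\<^sub>R gy p)) (at p)"
    using assms(4,5) p by simp
qed

lemma grad_on_unique:
  assumes "grad_on S f fx fy" and "grad_on S f gx gy" and "p \<in> S"
  shows "fx p = gx p" "fy p = gy p"
proof -
  have e: "(\<lambda>h::real\<times>real. fst h *\<^sub>R fx p + snd h *\<^sub>R fy p) = (\<lambda>h. fst h *\<^sub>R gx p + snd h *\<^sub>R gy p)"
    using assms has_derivative_unique unfolding grad_on_def by blast
  show "fx p = gx p" using fun_cong[OF e, of "(1,0)"] by simp
  show "fy p = gy p" using fun_cong[OF e, of "(0,1)"] by simp
qed

declare Ck.simps(2) [simp del]

lemma Ck_SucI:
  "grad_on S f fx fy \<Longrightarrow> Ck n S fx \<Longrightarrow> Ck n S fy \<Longrightarrow> Ck (Suc n) S f"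
  unfolding Ck.simps by blast

lemma Ck_SucE:
  assumes "Ck (Suc n) S f"
  obtains fx fy where "grad_on S f fx fy" "Ck n S fx" "Ck n S fy"
  using assms unfolding Ck.simps by blast

lemma Ck_continuous: "Ck n S f \<Longrightarrow> continuous_on S f"
  by (cases n) (auto elim: Ck_SucE intro: grad_on_continuous)

lemma Ck_cong:
  assumes "open S" and "Ck n S f" and "\<And>p. p \<in> S \<Longrightarrow> f p = g p"
  shows "Ck n S g"
proof (cases n)
  case 0
  then show ?thesis using assms continuous_on_cong[of S S f g] by auto
next
  case (Suc m)
  then obtain fx fy where f: "grad_on S f fx fy" "Ck m S fx" "Ck m S fy"
    using assms(2) Ck_SucE by blast
  have "grad_on S g fx fy" by (rule grad_on_cong[OF assms(1) f(1) assms(3)]) auto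
  then show ?thesis using Suc f Ck_SucI by blast
qed

lemma Ck_lower: "Ck (Suc n) S f \<Longrightarrow> Ck n S f"
proof (induction n arbitrary: f)
  case 0
  then show ?case using Ck_continuous by auto
next
  case (Suc n)
  obtain fx fy where f: "grad_on S f fx fy" "Ck (Suc n) S fx" "Ck (Suc n) S fy"
    using Suc.prems by (rule Ck_SucE)
  show ?case by (rule Ck_SucI[OF f(1)]) (rule Suc.IH f)+
qed

text \<open>The total derivative is unique, so the witnesses hidden in \<open>Ck\<close> agree on
  \<open>S\<close> with any known gradient. This makes regularity of concrete partial derivatives
  available.\<close>

lemma Ck_Suc_grad:
  assumes "open S" and "grad_on S f fx fy"
  shows "Ck (Suc n) S f \<longleftrightarrow> Ck n S fx \<and> Ck n S fy"
proof
  assume "Ck (Suc n) S f"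
  then obtain gx gy where g: "grad_on S f gx gy" "Ck n S gx" "Ck n S gy" by (rule Ck_SucE)
  show "Ck n S fx \<and> Ck n S fy"
    using Ck_cong[OF assms(1) g(2) grad_on_unique(1)[OF g(1) assms(2)]]
      Ck_cong[OF assms(1) g(3) grad_on_unique(2)[OF g(1) assms(2)]] by blast
qed (use assms Ck_SucI in blast)

lemma Cinf_grad:
  assumes "open S" and "grad_on S f fx fy"
  shows "Cinf S f \<longleftrightarrow> Cinf S fx \<and> Cinf S fy"
  unfolding Cinf_def using Ck_Suc_grad[OF assms] Ck_lower[of _ S f] by metis

lemma Cinf_obtain_grad:
  assumes "open S" and "Cinf S f"
  obtains fx fy where "grad_on S f fx fy" "Cinf S fx" "Cinf S fy"
proof -
  have "Ck (Suc 0) S f" using assms(2) unfolding Cinf_def by blast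
  then obtain fx fy where f: "grad_on S f fx fy" by (rule Ck_SucE)
  with that Cinf_grad[OF assms(1) f] assms(2) show ?thesis by blast
qed

lemma Cinf_cong:
  assumes "open S" and "Cinf S f" and "\<And>p. p \<in> S \<Longrightarrow> f p = g p"
  shows "Cinf S g"
  using assms Ck_cong unfolding Cinf_def by blast

lemma Cinf_continuous: "Cinf S f \<Longrightarrow> continuous_on S f"
  using Ck_continuous unfolding Cinf_def by blast

section \<open>Calculus rules for gradients and closure properties of the classes
  \<open>Ck\<close>\<close>

lemma grad_on_const: "grad_on S (\<lambda>p. c) (\<lambda>p. 0) (\<lambda>p. 0)"
  by (simp add: grad_on_def)

lemma grad_on_add:
  assumes "grad_on S f fx fy" and "grad_on S g gx gy"
  shows "grad_on S (\<lambda>p. f p + g p) (\<lambda>p. fx p + gx p) (\<lambda>p. fy p + gy p)"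
proof (rule grad_onI, goal_cases)
  case p: (1 p)
  note d = assms[THEN grad_onD, OF p]
  show ?case
    by (rule has_derivative_eq_rhs[OF has_derivative_add[OF d]]) (simp add: algebra_simps fun_eq_iff)
qed

lemma grad_on_minus:
  assumes "grad_on S f fx fy"
  shows "grad_on S (\<lambda>p. - f p) (\<lambda>p. - fx p) (\<lambda>p. - fy p)"
proof (rule grad_onI, goal_cases)
  case p: (1 p)
  note d = assms[THEN grad_onD, OF p]
  show ?case
    by (rule has_derivative_eq_rhs[OF has_derivative_minus[OF d]]) (simp add: algebra_simps fun_eq_iff)
qed

lemma grad_on_diff:
  assumes "grad_on S f fx fy" and "grad_on S g gx gy"
  shows "grad_on S (\<lambda>p. f p - g p) (\<lambda>p. fx p - gx p) (\<lambda>p. fy p - gy p)"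
proof (rule grad_onI, goal_cases)
  case p: (1 p)
  note d = assms[THEN grad_onD, OF p]
  show ?case
    by (rule has_derivative_eq_rhs[OF has_derivative_diff[OF d]]) (simp add: algebra_simps fun_eq_iff)
qed

lemma grad_on_mult:
  fixes f g :: "real \<times> real \<Rightarrow> real"
  assumes "grad_on S f fx fy" and "grad_on S g gx gy"
  shows "grad_on S (\<lambda>p. f p * g p) (\<lambda>p. fx p * g p + f p * gx p) (\<lambda>p. fy p * g p + f p * gy p)"
proof (rule grad_onI, goal_cases)
  case p: (1 p)
  note d = assms[THEN grad_onD, OF p]
  show ?case
    by (rule has_derivative_eq_rhs[OF has_derivative_mult[OF d]]) (simp add: algebra_simps fun_eq_iff)
qed

lemma grad_on_scaleR_const:
  fixes f :: "real \<times> real \<Rightarrow> real" and A :: "'a::real_normed_vector"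
  assumes "grad_on S f fx fy"
  shows "grad_on S (\<lambda>p. f p *\<^sub>R A) (\<lambda>p. fx p *\<^sub>R A) (\<lambda>p. fy p *\<^sub>R A)"
proof (rule grad_onI, goal_cases)
  case p: (1 p)
  note d = assms[THEN grad_onD, OF p]
  show ?case
    by (rule has_derivative_eq_rhs[OF has_derivative_scaleR_left[OF d]]) (simp add: algebra_simps fun_eq_iff)
qed

lemma grad_on_sin:
  fixes f :: "real \<times> real \<Rightarrow> real"
  assumes "grad_on S f fx fy"
  shows "grad_on S (\<lambda>p. sin (f p)) (\<lambda>p. cos (f p) * fx p) (\<lambda>p. cos (f p) * fy p)"
proof (rule grad_onI, goal_cases)
  case p: (1 p)
  note d = assms[THEN grad_onD, OF p]
  show ?case
    by (rule has_derivative_eq_rhs[OF has_derivative_sin[OF d]]) (simp add: algebra_simps fun_eq_iff)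
qed

lemma grad_on_cos:
  fixes f :: "real \<times> real \<Rightarrow> real"
  assumes "grad_on S f fx fy"
  shows "grad_on S (\<lambda>p. cos (f p)) (\<lambda>p. - sin (f p) * fx p) (\<lambda>p. - sin (f p) * fy p)"
proof (rule grad_onI, goal_cases)
  case p: (1 p)
  note d = assms[THEN grad_onD, OF p]
  show ?case
    by (rule has_derivative_eq_rhs[OF has_derivative_cos[OF d]]) (simp add: algebra_simps fun_eq_iff)
qed

lemma grad_on_diag_fst:
  fixes f :: "real \<times> real \<Rightarrow> 'a::real_normed_vector"
  assumes "grad_on (I \<times> I) f fx fy"
  shows "grad_on (I \<times> I) (\<lambda>p. f (fst p, fst p)) (\<lambda>p. fx (fst p, fst p) + fy (fst p, fst p)) (\<lambda>p. 0)"
  unfolding grad_on_def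
proof
  fix p :: "real \<times> real" assume "p \<in> I \<times> I"
  then have "(f has_derivative (\<lambda>h. fst h *\<^sub>R fx (fst p, fst p) + snd h *\<^sub>R fy (fst p, fst p)))
      (at (fst p, fst p))"
    using assms by (auto simp: grad_on_def)
  moreover have "((\<lambda>p. (fst p, fst p)) has_derivative (\<lambda>h. (fst h, fst h))) (at p)"
    by (auto intro!: derivative_eq_intros)
  ultimately have "((\<lambda>p. f (fst p, fst p)) has_derivative
      (\<lambda>h. fst h *\<^sub>R fx (fst p, fst p) + fst h *\<^sub>R fy (fst p, fst p))) (at p)"
    using has_derivative_compose[of "\<lambda>p. (fst p, fst p)" "\<lambda>h. (fst h, fst h)" p UNIV f
        "\<lambda>h. fst h *\<^sub>R fx (fst p, fst p) + snd h *\<^sub>R fy (fst p, fst p)"] by simp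
  then show "((\<lambda>p. f (fst p, fst p)) has_derivative
      (\<lambda>h. fst h *\<^sub>R (fx (fst p, fst p) + fy (fst p, fst p)) + snd h *\<^sub>R 0)) (at p)"
    by (simp add: algebra_simps)
qed

lemma grad_on_swap:
  fixes f :: "real \<times> real \<Rightarrow> 'a::real_normed_vector"
  assumes "grad_on (I \<times> I) f fx fy"
  shows "grad_on (I \<times> I) (\<lambda>p. f (prod.swap p)) (\<lambda>p. fy (prod.swap p)) (\<lambda>p. fx (prod.swap p))"
  unfolding grad_on_def
proof
  fix p :: "real \<times> real" assume "p \<in> I \<times> I"
  then have "(f has_derivative (\<lambda>h. fst h *\<^sub>R fx (prod.swap p) + snd h *\<^sub>R fy (prod.swap p)))
      (at (prod.swap p))"
    using assms by (auto simp: grad_on_def)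
  moreover have "(prod.swap has_derivative prod.swap) (at p)"
    unfolding prod.swap_def[abs_def] by (auto intro!: derivative_eq_intros)
  ultimately have "((\<lambda>p. f (prod.swap p)) has_derivative
      (\<lambda>h. snd h *\<^sub>R fx (prod.swap p) + fst h *\<^sub>R fy (prod.swap p))) (at p)"
    using has_derivative_compose[of prod.swap prod.swap p UNIV f
        "\<lambda>h. fst h *\<^sub>R fx (prod.swap p) + snd h *\<^sub>R fy (prod.swap p)"] by simp
  then show "((\<lambda>p. f (prod.swap p)) has_derivative
      (\<lambda>h. fst h *\<^sub>R fy (prod.swap p) + snd h *\<^sub>R fx (prod.swap p))) (at p)"
    by (simp add: algebra_simps)
qed

lemma grad_on_fst:
  fixes f :: "real \<Rightarrow> real"
  assumes "\<And>t. t \<in> I \<Longrightarrow> (f has_real_derivative f' t) (at t)"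
  shows "grad_on (I \<times> I) (\<lambda>p. f (fst p)) (\<lambda>p. f' (fst p)) (\<lambda>p. 0)"
  unfolding grad_on_def
proof
  fix p :: "real \<times> real" assume "p \<in> I \<times> I"
  then have "(f has_derivative (\<lambda>h. h * f' (fst p))) (at (fst p))"
    using assms[of "fst p"] by (auto simp: has_field_derivative_def mult.commute[of _ "f' _"])
  then have "((\<lambda>p. f (fst p)) has_derivative (\<lambda>h. fst h * f' (fst p))) (at p)"
    by (rule has_derivative_compose[OF has_derivative_fst[OF has_derivative_ident]])
  then show "((\<lambda>p. f (fst p)) has_derivative (\<lambda>h. fst h *\<^sub>R f' (fst p) + snd h *\<^sub>R 0)) (at p)"
    by simp
qed

lemma Ck_const: "Ck n S (\<lambda>p. c)"
proof (induction n arbitrary: c)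
  case (Suc n)
  show ?case by (rule Ck_SucI[OF grad_on_const Suc Suc])
qed auto

lemma Ck_add: "Ck n S f \<Longrightarrow> Ck n S g \<Longrightarrow> Ck n S (\<lambda>p. f p + g p)"
proof (induction n arbitrary: f g)
  case (Suc n)
  obtain fx fy where f: "grad_on S f fx fy" "Ck n S fx" "Ck n S fy"
    using Suc.prems(1) by (rule Ck_SucE)
  obtain gx gy where g: "grad_on S g gx gy" "Ck n S gx" "Ck n S gy"
    using Suc.prems(2) by (rule Ck_SucE)
  show ?case
    by (rule Ck_SucI[OF grad_on_add[OF f(1) g(1)]]) (intro Suc.IH f g)+
qed (simp add: continuous_on_add)

lemma Ck_minus: "Ck n S f \<Longrightarrow> Ck n S (\<lambda>p. - f p)"
proof (induction n arbitrary: f)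
  case (Suc n)
  obtain fx fy where f: "grad_on S f fx fy" "Ck n S fx" "Ck n S fy"
    using Suc.prems by (rule Ck_SucE)
  show ?case
    by (rule Ck_SucI[OF grad_on_minus[OF f(1)]]) (intro Suc.IH f)+
qed (simp add: continuous_on_minus)

lemma Ck_diff: "Ck n S f \<Longrightarrow> Ck n S g \<Longrightarrow> Ck n S (\<lambda>p. f p - g p)"
  using Ck_add[of n S f "\<lambda>p. - g p"] Ck_minus[of n S g] by simp

lemma Ck_mult:
  fixes f g :: "real \<times> real \<Rightarrow> real"
  shows "Ck n S f \<Longrightarrow> Ck n S g \<Longrightarrow> Ck n S (\<lambda>p. f p * g p)"
proof (induction n arbitrary: f g)
  case (Suc n)
  obtain fx fy where f: "grad_on S f fx fy" "Ck n S fx" "Ck n S fy"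
    using Suc.prems(1) by (rule Ck_SucE)
  obtain gx gy where g: "grad_on S g gx gy" "Ck n S gx" "Ck n S gy"
    using Suc.prems(2) by (rule Ck_SucE)
  show ?case
    by (rule Ck_SucI[OF grad_on_mult[OF f(1) g(1)]])
      (intro Ck_add Suc.IH f g Suc.prems[THEN Ck_lower])+
qed (simp add: continuous_on_mult)

lemma Ck_scaleR_const:
  fixes f :: "real \<times> real \<Rightarrow> real" and A :: "'a::real_normed_vector"
  shows "Ck n S f \<Longrightarrow> Ck n S (\<lambda>p. f p *\<^sub>R A)"
proof (induction n arbitrary: f)
  case (Suc n)
  obtain fx fy where f: "grad_on S f fx fy" "Ck n S fx" "Ck n S fy"
    using Suc.prems by (rule Ck_SucE)
  show ?case
    by (rule Ck_SucI[OF grad_on_scaleR_const[OF f(1)]]) (intro Suc.IH f)+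
qed (simp add: continuous_on_scaleR)

text \<open>Differentiation exchanges the two functions, so neither claim is inductive
  alone.\<close>

lemma Ck_sin_cos:
  fixes f :: "real \<times> real \<Rightarrow> real"
  shows "Ck n S f \<Longrightarrow> Ck n S (\<lambda>p. sin (f p)) \<and> Ck n S (\<lambda>p. cos (f p))"
proof (induction n arbitrary: f)
  case (Suc n)
  obtain fx fy where f: "grad_on S f fx fy" "Ck n S fx" "Ck n S fy"
    using Suc.prems by (rule Ck_SucE)
  have sc: "Ck n S (\<lambda>p. sin (f p))" "Ck n S (\<lambda>p. cos (f p))"
    using Suc.IH[OF Ck_lower[OF Suc.prems]] by blast+
  have "Ck (Suc n) S (\<lambda>p. sin (f p))"
    by (rule Ck_SucI[OF grad_on_sin[OF f(1)]]) (intro Ck_mult sc f)+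
  moreover have "Ck (Suc n) S (\<lambda>p. cos (f p))"
    by (rule Ck_SucI[OF grad_on_cos[OF f(1)]]) (intro Ck_mult Ck_minus sc f)+
  ultimately show ?case by blast
qed (simp add: continuous_on_sin continuous_on_cos)

lemma Ck_diag_fst: "Ck n (I \<times> I) f \<Longrightarrow> Ck n (I \<times> I) (\<lambda>p. f (fst p, fst p))"
proof (induction n arbitrary: f)
  case 0
  then have "continuous_on (I \<times> I) f" by simp
  then have "continuous_on (I \<times> I) (\<lambda>p. f (fst p, fst p))"
    by (rule continuous_on_compose2[where f = "\<lambda>p. (fst p, fst p)" and t = "I \<times> I"])
      (auto intro!: continuous_on_Pair continuous_on_fst continuous_on_snd continuous_on_id)
  then show ?case by simp
next
  case (Suc n)
  obtain fx fy where f: "grad_on (I \<times> I) f fx fy" "Ck n (I \<times> I) fx" "Ck n (I \<times> I) fy"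
    using Suc.prems by (rule Ck_SucE)
  show ?case
    by (rule Ck_SucI[OF grad_on_diag_fst[OF f(1)]]) (rule Ck_add Ck_const Suc.IH[of fx] Suc.IH[of fy] f)+
qed

lemma Ck_swap: "Ck n (I \<times> I) f \<Longrightarrow> Ck n (I \<times> I) (\<lambda>p. f (prod.swap p))"
proof (induction n arbitrary: f)
  case 0
  then have "continuous_on (I \<times> I) f" by simp
  then have "continuous_on (I \<times> I) (\<lambda>p. f (prod.swap p))"
    unfolding prod.swap_def
    by (rule continuous_on_compose2[where f = "\<lambda>p. (snd p, fst p)" and t = "I \<times> I"])
      (auto intro!: continuous_on_Pair continuous_on_fst continuous_on_snd continuous_on_id)
  then show ?case by simp
next
  case (Suc n)
  obtain fx fy where f: "grad_on (I \<times> I) f fx fy" "Ck n (I \<times> I) fx" "Ck n (I \<times> I) fy"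
    using Suc.prems by (rule Ck_SucE)
  show ?case
    by (rule Ck_SucI[OF grad_on_swap[OF f(1)]]) (rule Suc.IH[of fx] Suc.IH[of fy] f)+
qed

lemma Cinf_sin_cos:
  fixes f :: "real \<times> real \<Rightarrow> real"
  assumes "Cinf S f" shows "Cinf S (\<lambda>p. sin (f p))" "Cinf S (\<lambda>p. cos (f p))"
  using assms Ck_sin_cos unfolding Cinf_def by blast+

lemma Cinf_algebra:
  "Cinf S (\<lambda>p. c)"
  "Cinf S f \<Longrightarrow> Cinf S g \<Longrightarrow> Cinf S (\<lambda>p. f p + g p)"
  "Cinf S f \<Longrightarrow> Cinf S g \<Longrightarrow> Cinf S (\<lambda>p. f p - g p)"
  "Cinf S f \<Longrightarrow> Cinf S (\<lambda>p. - f p)"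
  using Ck_const Ck_add Ck_diff Ck_minus unfolding Cinf_def by blast+

lemma Cinf_mult:
  fixes f g :: "real \<times> real \<Rightarrow> real"
  shows "Cinf S f \<Longrightarrow> Cinf S g \<Longrightarrow> Cinf S (\<lambda>p. f p * g p)"
  using Ck_mult unfolding Cinf_def by blast

lemma Cinf_scaleR_const:
  fixes f :: "real \<times> real \<Rightarrow> real" and A :: "'a::real_normed_vector"
  shows "Cinf S f \<Longrightarrow> Cinf S (\<lambda>p. f p *\<^sub>R A)"
  using Ck_scaleR_const unfolding Cinf_def by blast

section \<open>From gradients to the partial derivatives in the definition of smoothness\<close>

lemma grad_on_vector_derivative:
  assumes "grad_on S f fx fy" and "p \<in> S"
  shows "((\<lambda>s. f (s, snd p)) has_vector_derivative fx p) (at (fst p))"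
    and "((\<lambda>s. f (fst p, s)) has_vector_derivative fy p) (at (snd p))"
proof -
  have d: "(f has_derivative (\<lambda>h. fst h *\<^sub>R fx p + snd h *\<^sub>R fy p)) (at p)"
    using assms by (auto simp: grad_on_def)
  have "((\<lambda>s. (s, snd p)) has_derivative (\<lambda>h. (h, 0))) (at (fst p))"
    by (auto intro!: derivative_eq_intros)
  then show "((\<lambda>s. f (s, snd p)) has_vector_derivative fx p) (at (fst p))"
    using has_derivative_compose[of "\<lambda>s. (s, snd p)" "\<lambda>h. (h, 0)" "fst p" UNIV f
        "\<lambda>h. fst h *\<^sub>R fx p + snd h *\<^sub>R fy p"] d
    by (simp add: has_vector_derivative_def)
  have "((\<lambda>s. (fst p, s)) has_derivative (\<lambda>h. (0, h))) (at (snd p))"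
    by (auto intro!: derivative_eq_intros)
  then show "((\<lambda>s. f (fst p, s)) has_vector_derivative fy p) (at (snd p))"
    using has_derivative_compose[of "\<lambda>s. (fst p, s)" "\<lambda>h. (0, h)" "snd p" UNIV f
        "\<lambda>h. fst h *\<^sub>R fx p + snd h *\<^sub>R fy p"] d
    by (simp add: has_vector_derivative_def)
qed

lemma grad_on_real_derivative:
  fixes f :: "real \<times> real \<Rightarrow> real"
  assumes "grad_on (I \<times> I) f fx fy" and "x \<in> I" and "y \<in> I"
  shows "((\<lambda>s. f (s, y)) has_real_derivative fx (x, y)) (at x)"
    and "((\<lambda>s. f (x, s)) has_real_derivative fy (x, y)) (at y)"
  using grad_on_vector_derivative[OF assms(1), of "(x, y)"] assms(2,3)
  by (auto simp: has_real_derivative_iff_has_vector_derivative)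

lemma grad_on_Dx_Dy:
  assumes "grad_on S f fx fy" and "p \<in> S"
  shows "Dx f p = fx p" "Dy f p = fy p"
  using grad_on_vector_derivative[OF assms] unfolding Dx_def Dy_def
  by (auto intro: vector_derivative_at)

text \<open>\<open>Dx f\<close> and \<open>Dy f\<close> agree with the gradient only on
  \<open>S\<close>; openness lets \<open>Cinf\<close> pass across this agreement, and the class is
  then stable under every word of partial derivatives.\<close>

lemma Cinf_smooth2_on:
  assumes "open S" and "Cinf S f"
  shows "smooth2_on S f"
proof -
  have Cinf_Dpart: "Cinf S (Dpart bs f)" for bs
    using assms(2)
  proof (induction bs arbitrary: f)
    case (Cons b bs)
    obtain fx fy where g: "grad_on S f fx fy" "Cinf S fx" "Cinf S fy"
      using Cinf_obtain_grad[OF assms(1) Cons.prems] .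
    have "Cinf S (Dx f)" "Cinf S (Dy f)"
      using g(2,3)[THEN Cinf_cong[OF assms(1)]] grad_on_Dx_Dy[OF g(1)] by auto
    then show ?case using Cons.IH by auto
  qed auto
  show ?thesis unfolding smooth2_on_def
  proof (intro allI conjI ballI)
    fix bs p assume "p \<in> S"
    obtain fx fy where g: "grad_on S (Dpart bs f) fx fy"
      using Cinf_obtain_grad[OF assms(1) Cinf_Dpart] by blast
    show "(\<lambda>s. Dpart bs f (s, snd p)) differentiable at (fst p)"
      and "(\<lambda>s. Dpart bs f (fst p, s)) differentiable at (snd p)"
      using grad_on_vector_derivative[OF g \<open>p \<in> S\<close>]
      by (auto simp: has_vector_derivative_def differentiable_def)
  qed (use Cinf_Dpart Cinf_continuous in blast)
qed

section \<open>Integration from the diagonal\<close>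

text \<open>Coefficients are bounded only on compact squares. Any two points of \<open>I\<close> lie
  in the interior of a common compact interval, whose square also contains the relevant part of the
  diagonal.\<close>

lemma open_interval_box:
  fixes I :: "real set"
  assumes "open I" "is_interval I" "u \<in> I" "v \<in> I"
  obtains a b where "{a..b} \<subseteq> I" "a < u" "u < b" "a < v" "v < b"
proof -
  have m: "min u v \<in> I" "max u v \<in> I" using assms(3,4) by (auto simp: min_def max_def)
  obtain e where e: "e > 0" "cball (min u v) e \<subseteq> I"
    using m(1) assms(1) open_contains_cball by blast
  obtain d where d: "d > 0" "cball (max u v) d \<subseteq> I"
    using m(2) assms(1) open_contains_cball by blast
  have "min u v - e \<in> I" "max u v + d \<in> I"
    using e d by (auto simp: subset_iff dist_real_def)
  then have "{min u v - e..max u v + d} \<subseteq> I"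
    using assms(2) unfolding is_interval_1 subset_iff atLeastAtMost_iff by blast
  then show ?thesis using that e(1) d(1) by (smt (verit))
qed

lemma interval_segment_mem:
  fixes I :: "real set"
  assumes "is_interval I" "u \<in> I" "v \<in> I" "0 \<le> \<theta>" "\<theta> \<le> 1"
  shows "u + \<theta> * (v - u) \<in> I"
proof -
  have "convex I" using assms(1) is_interval_convex by blast
  from convexD_alt[OF this assms(2,3,4,5)] show ?thesis by (simp add: algebra_simps)
qed

text \<open>This is the integral of f(x, s) ds from \<open>t0\<close> to y, rescaled to the fixed
  domain [0, 1]: the sign is right when y < t0 as well, and theorems on integrals depending on a
  parameter apply in both variables.\<close>

definition antiy :: "real \<Rightarrow> (real \<times> real \<Rightarrow> real) \<Rightarrow> real \<times> real \<Rightarrow> real" where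
  "antiy t0 f p = (snd p - t0) * integral (cbox 0 1) (\<lambda>\<theta>. f (fst p, t0 + \<theta> * (snd p - t0)))"

lemma antiy_deriv_y:
  assumes I: "open I" "is_interval I" "t0 \<in> I"
    and f: "continuous_on (I \<times> I) f" and xy: "x \<in> I" "y \<in> I"
  shows "((\<lambda>s. antiy t0 f (x, s)) has_real_derivative f (x, y)) (at y)"
proof -
  obtain a b where ab: "{a..b} \<subseteq> I" "a < t0" "t0 < b" "a < y" "y < b"
    using open_interval_box[OF I xy(2)] .
  have "continuous_on {a..b} (\<lambda>s. f (x, s))"
    by (rule continuous_on_compose2[OF f, where f = "\<lambda>s. (x, s)"])
      (use ab xy in \<open>auto intro!: continuous_on_Pair continuous_on_const continuous_on_id\<close>)
  then obtain G where G: "\<And>s. s \<in> {a..b} \<Longrightarrow> (G has_vector_derivative f (x, s)) (at s within {a..b})"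
    using antiderivative_continuous by blast
  \<comment> \<open>Undoing the rescaling by the substitution \<open>h\<close> identifies
    \<open>antiy\<close> with an ordinary antiderivative, on an open interval around y.\<close>
  have eq: "antiy t0 f (x, s) = G s - G t0" if s: "s \<in> {a<..<b}" for s
  proof -
    define h where "h \<theta> = t0 + \<theta> * (s - t0)" for \<theta>
    have h: "h \<theta> \<in> {a..b}" if "\<theta> \<in> {0..1}" for \<theta>
      using interval_segment_mem[of "{a..b}" t0 s \<theta>] that s ab by (auto simp: h_def)
    have "((G \<circ> h) has_vector_derivative (s - t0) *\<^sub>R f (x, h \<theta>)) (at \<theta> within {0..1})"
      if "\<theta> \<in> {0..1}" for \<theta>
    proof (rule vector_diff_chain_within)
      show "(h has_vector_derivative (s - t0)) (at \<theta> within {0..1})"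
        unfolding h_def by (auto intro!: derivative_eq_intros)
      show "(G has_vector_derivative f (x, h \<theta>)) (at (h \<theta>) within h ` {0..1})"
        by (rule has_vector_derivative_within_subset[OF G]) (use h that in auto)
    qed
    then have "((\<lambda>\<theta>. (s - t0) *\<^sub>R f (x, h \<theta>)) has_integral ((G \<circ> h) 1 - (G \<circ> h) 0)) {0..1}"
      by (rule fundamental_theorem_of_calculus[rotated]) simp_all
    from integral_unique[OF this] show ?thesis by (simp add: antiy_def h_def)
  qed
  have "(G has_real_derivative f (x, y)) (at y)"
    using G[of y] ab by (auto simp: has_real_derivative_iff_has_vector_derivative at_within_Icc_at)
  then have "((\<lambda>s. G s - G t0) has_real_derivative f (x, y)) (at y)"
    by (auto intro!: derivative_eq_intros)
  then show ?thesis
    by (rule has_field_derivative_transform_within_open[of _ _ _ "{a<..<b}"]) (use ab eq in auto)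
qed

lemma continuous_on_antiy_integrand:
  assumes "is_interval I" "(t0::real) \<in> I" "continuous_on (I \<times> I) f"
  shows "continuous_on ((I \<times> I) \<times> cbox 0 1) (\<lambda>(p, \<theta>). f (fst p, t0 + \<theta> * (snd p - t0)))"
  unfolding split_beta
  by (rule continuous_on_compose2[OF assms(3),
        where f = "\<lambda>q. (fst (fst q), t0 + snd q * (snd (fst q) - t0))"])
    (use interval_segment_mem[OF assms(1,2)] in
      \<open>auto intro!: continuous_on_Pair continuous_on_fst continuous_on_snd continuous_on_id
        continuous_on_add continuous_on_mult continuous_on_diff continuous_on_const\<close>)

lemma continuous_on_antiy:
  assumes "is_interval I" "t0 \<in> I" "continuous_on (I \<times> I) f"
  shows "continuous_on (I \<times> I) (antiy t0 f)"
  unfolding antiy_def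
  by (intro continuous_on_mult continuous_on_diff continuous_on_snd continuous_on_id
      continuous_on_const integral_continuous_on_param continuous_on_antiy_integrand assms)

lemma antiy_deriv_x:
  assumes I: "open I" "is_interval I" "t0 \<in> I"
    and f: "continuous_on (I \<times> I) f" "continuous_on (I \<times> I) fx"
    and d: "\<And>x y. x \<in> I \<Longrightarrow> y \<in> I \<Longrightarrow> ((\<lambda>s. f (s, y)) has_real_derivative fx (x, y)) (at x)"
    and xy: "x \<in> I" "y \<in> I"
  shows "((\<lambda>s. antiy t0 f (s, y)) has_real_derivative antiy t0 fx (x, y)) (at x)"
proof -
  let ?h = "\<lambda>\<theta>. t0 + \<theta> * (y - t0)"
  have h: "?h \<theta> \<in> I" if "\<theta> \<in> cbox 0 1" for \<theta>
    using interval_segment_mem[OF I(2,3) xy(2)] that by auto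
  have "((\<lambda>s. integral (cbox 0 1) (\<lambda>\<theta>. f (s, ?h \<theta>))) has_field_derivative
      integral (cbox 0 1) (\<lambda>\<theta>. fx (x, ?h \<theta>))) (at x within I)"
  proof (rule leibniz_rule_field_derivative)
    show "((\<lambda>s. f (s, ?h \<theta>)) has_real_derivative fx (s, ?h \<theta>)) (at s within I)"
      if "s \<in> I" "\<theta> \<in> cbox 0 1" for s \<theta>
      using d[OF that(1) h[OF that(2)]] by (rule has_field_derivative_at_within)
    show "(\<lambda>\<theta>. f (s, ?h \<theta>)) integrable_on cbox 0 1" if "s \<in> I" for s
      by (intro integrable_continuous continuous_on_compose2[OF f(1), where f = "\<lambda>\<theta>. (s, ?h \<theta>)"])
        (use h that in \<open>auto intro!: continuous_on_Pair continuous_on_id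
          continuous_on_add continuous_on_mult continuous_on_const\<close>)
    show "continuous_on (I \<times> cbox 0 1) (\<lambda>(s, \<theta>). fx (s, ?h \<theta>))"
      unfolding split_beta
      by (rule continuous_on_compose2[OF f(2), where f = "\<lambda>q. (fst q, ?h (snd q))"])
        (use h in \<open>auto intro!: continuous_on_Pair continuous_on_id continuous_on_fst
          continuous_on_snd continuous_on_add continuous_on_mult continuous_on_const\<close>)
    show "convex I" using I(2) is_interval_convex by blast
  qed (use xy in auto)
  then have "((\<lambda>s. integral (cbox 0 1) (\<lambda>\<theta>. f (s, ?h \<theta>))) has_field_derivative
      integral (cbox 0 1) (\<lambda>\<theta>. fx (x, ?h \<theta>))) (at x)"
    using at_within_open[OF xy(1) I(1)] by simp
  from DERIV_cmult[OF this, of "y - t0"] show ?thesis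
    by (simp add: antiy_def)
qed

text \<open>Total differentiability needs continuity of only one partial derivative next to the
  existence of the other. For \<open>antiy\<close> that one is the integrand itself.\<close>

lemma grad_on_partials:
  assumes I: "open I" "is_interval I"
    and c: "continuous_on (I \<times> I) fy"
    and dx: "\<And>x y. x \<in> I \<Longrightarrow> y \<in> I \<Longrightarrow> ((\<lambda>s. f (s, y)) has_real_derivative fx (x, y)) (at x)"
    and dy: "\<And>x y. x \<in> I \<Longrightarrow> y \<in> I \<Longrightarrow> ((\<lambda>s. f (x, s)) has_real_derivative fy (x, y)) (at y)"
  shows "grad_on (I \<times> I) f fx fy"
proof (rule grad_onI)
  fix p :: "real \<times> real" assume "p \<in> I \<times> I"
  then obtain x y where p: "p = (x, y)" and xy: "x \<in> I" "y \<in> I" by auto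
  have "((\<lambda>(x, y). f (x, y)) has_derivative
      (\<lambda>(tx, ty). tx * fx (x, y) + blinfun_apply (blinfun_scaleR_left (fy (x, y))) ty))
      (at (x, y) within I \<times> I)"
  proof (rule has_derivative_partialsI[where f = "\<lambda>x y. f (x, y)"
        and fy = "\<lambda>x y. blinfun_scaleR_left (fy (x, y))"])
    show "((\<lambda>x. f (x, y)) has_derivative (\<lambda>t. t * fx (x, y))) (at x within I)"
      by (rule has_derivative_eq_rhs[OF has_field_derivative_at_within[OF dx[OF xy],
            unfolded has_field_derivative_def]]) auto
    show "((\<lambda>y. f (x, y)) has_derivative blinfun_apply (blinfun_scaleR_left (fy (x, y))))
        (at y within I)" if "x \<in> I" "y \<in> I" for x y
      by (rule has_derivative_eq_rhs[OF has_field_derivative_at_within[OF dy[OF that],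
            unfolded has_field_derivative_def]]) auto
    have "continuous (at (x, y) within I \<times> I) fy"
      using c xy by (auto simp: continuous_on_eq_continuous_within)
    then show "continuous (at (x, y) within I \<times> I) (\<lambda>(x, y). blinfun_scaleR_left (fy (x, y)))"
      unfolding split_beta prod.collapse
      by (rule bounded_linear.continuous[OF bounded_linear_blinfun_scaleR_left])
    show "convex I" using I(2) is_interval_convex by blast
  qed (rule xy)
  then show "(f has_derivative (\<lambda>h. fst h *\<^sub>R fx p + snd h *\<^sub>R fy p)) (at p)"
    using at_within_open[of p "I \<times> I"] I(1) xy open_Times[of I I] by (simp add: p case_prod_unfold)
qed

lemma grad_on_antiy:
  assumes "open I" "is_interval I" "t0 \<in> I"
    and "continuous_on (I \<times> I) f" "continuous_on (I \<times> I) fx"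
    and "\<And>x y. x \<in> I \<Longrightarrow> y \<in> I \<Longrightarrow> ((\<lambda>s. f (s, y)) has_real_derivative fx (x, y)) (at x)"
  shows "grad_on (I \<times> I) (antiy t0 f) (antiy t0 fx) f"
  by (rule grad_on_partials)
    (use assms antiy_deriv_x[OF assms(1-5)] antiy_deriv_y[OF assms(1-4)] in auto)

text \<open>The y-derivative of \<open>antiy t0 f\<close> is \<open>f\<close>, and its x-derivative
  is \<open>antiy\<close> of \<open>fx\<close>, which the induction hypothesis covers.\<close>

lemma Ck_antiy:
  assumes "open I" "is_interval I" "t0 \<in> I"
  shows "Ck n (I \<times> I) f \<Longrightarrow> Ck n (I \<times> I) (antiy t0 f)"
proof (induction n arbitrary: f)
  case 0
  then show ?case using continuous_on_antiy[OF assms(2,3)] by auto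
next
  case (Suc n)
  obtain fx fy where f: "grad_on (I \<times> I) f fx fy" "Ck n (I \<times> I) fx" "Ck n (I \<times> I) fy"
    using Suc.prems by (rule Ck_SucE)
  have "grad_on (I \<times> I) (antiy t0 f) (antiy t0 fx) f"
    by (rule grad_on_antiy[OF assms Ck_continuous[OF Suc.prems] Ck_continuous[OF f(2)]])
      (rule grad_on_real_derivative(1)[OF f(1)])
  then show ?case
    by (rule Ck_SucI) (use Suc.IH[OF f(2)] Ck_lower[OF Suc.prems] in auto)
qed

section \<open>Factorial estimates and uniqueness for the diagonal Cauchy problem\<close>

lemma factorial_bound_step_right:
  fixes g :: "real \<Rightarrow> real"
  assumes "a \<le> b" and "g a = 0"
    and d: "\<And>s. a \<le> s \<Longrightarrow> s \<le> b \<Longrightarrow> (g has_real_derivative g' s) (at s)"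
    and le: "\<And>s. a \<le> s \<Longrightarrow> s \<le> b \<Longrightarrow> g' s \<le> B * (s - a) ^ n / fact n"
  shows "g b \<le> B * (b - a) ^ Suc n / fact (Suc n)"
proof -
  \<comment> \<open>The integrated bound minus \<open>g\<close> has a nonnegative derivative, so
    monotonicity replaces integration of the inequality.\<close>
  define h where "h s = B * (s - a) ^ Suc n / fact (Suc n) - g s" for s
  have dh: "(h has_real_derivative (B * (s - a) ^ n / fact n - g' s)) (at s)"
    if "a \<le> s" "s \<le> b" for s
  proof -
    have "((\<lambda>s. (s - a) ^ Suc n) has_real_derivative real (Suc n) * (s - a) ^ n) (at s)"
      by (rule derivative_eq_intros refl)+ simp
    from DERIV_diff[OF DERIV_cmult[OF this, of "B / fact (Suc n)"] d[OF that]]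
    show ?thesis by (simp add: h_def[abs_def] field_simps del: of_nat_Suc power_Suc)
  qed
  have "h a \<le> h b"
    by (rule DERIV_nonneg_imp_nondecreasing[OF assms(1)]) (metis dh le diff_ge_0_iff_ge)
  then show ?thesis using assms(2) by (simp add: h_def)
qed

lemma factorial_bound_step_right_abs:
  fixes f :: "real \<Rightarrow> real"
  assumes "a \<le> b" and "f a = 0"
    and d: "\<And>s. a \<le> s \<Longrightarrow> s \<le> b \<Longrightarrow> (f has_real_derivative f' s) (at s)"
    and le: "\<And>s. a \<le> s \<Longrightarrow> s \<le> b \<Longrightarrow> \<bar>f' s\<bar> \<le> B * (s - a) ^ n / fact n"
  shows "\<bar>f b\<bar> \<le> B * (b - a) ^ Suc n / fact (Suc n)"
proof -
  have "f b \<le> B * (b - a) ^ Suc n / fact (Suc n)"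
    by (rule factorial_bound_step_right[of a b f f', OF assms(1,2) d]) (use le in \<open>auto dest: abs_le_D1\<close>)
  moreover have "- f b \<le> B * (b - a) ^ Suc n / fact (Suc n)"
    by (rule factorial_bound_step_right[of a b "\<lambda>s. - f s" "\<lambda>s. - f' s", OF assms(1)])
      (use assms(2) d[THEN DERIV_minus] le in \<open>auto dest: abs_le_D2\<close>)
  ultimately show ?thesis by linarith
qed

text \<open>One integration from \<open>a\<close>, in either direction, gains one power of the
  distance and one factor of the factorial. It drives both the uniqueness proof and the Picard
  iteration; with \<open>n\<close> = 0 it is a mean value inequality.\<close>

lemma factorial_bound_step:
  fixes f :: "real \<Rightarrow> real"
  assumes z: "f a = 0"
    and d: "\<And>s. s \<in> closed_segment a b \<Longrightarrow> (f has_real_derivative f' s) (at s)"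
    and le: "\<And>s. s \<in> closed_segment a b \<Longrightarrow> \<bar>f' s\<bar> \<le> B * \<bar>s - a\<bar> ^ n / fact n"
  shows "\<bar>f b\<bar> \<le> B * \<bar>b - a\<bar> ^ Suc n / fact (Suc n)"
proof (cases "a \<le> b")
  case True
  have "\<bar>f b\<bar> \<le> B * (b - a) ^ Suc n / fact (Suc n)"
  proof (rule factorial_bound_step_right_abs[OF True z d])
    show "\<bar>f' s\<bar> \<le> B * (s - a) ^ n / fact n" if "a \<le> s" "s \<le> b" for s
      using le[of s] that True by (simp add: closed_segment_eq_real_ivl)
  qed (use True in \<open>auto simp: closed_segment_eq_real_ivl\<close>)
  then show ?thesis using True by simp
next
  case False
  have "\<bar>f (- (- b))\<bar> \<le> B * (- b - (- a)) ^ Suc n / fact (Suc n)"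
  proof (rule factorial_bound_step_right_abs[of "-a" "-b" "\<lambda>s. f (- s)" "\<lambda>s. - f' (- s)"])
    show "((\<lambda>s. f (- s)) has_real_derivative - f' (- s)) (at s)" if "- a \<le> s" "s \<le> - b" for s
    proof -
      have "(f has_real_derivative f' (- s)) (at (- s))"
        using d[of "- s"] that False by (simp add: closed_segment_eq_real_ivl)
      then show ?thesis using DERIV_mirror by metis
    qed
    show "\<bar>- f' (- s)\<bar> \<le> B * (s - - a) ^ n / fact n" if "- a \<le> s" "s \<le> - b" for s
    proof -
      have "\<bar>- s - a\<bar> = s - - a" using that(1) by simp
      then show ?thesis using le[of "- s"] that False
        by (simp add: closed_segment_eq_real_ivl add.commute)
    qed
  qed (use False z in auto)
  then show ?thesis using False by simp
qed

lemma power_over_fact_tendsto_0: "(\<lambda>n. A * (x::real) ^ n / fact n) \<longlonglongrightarrow> 0"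
proof -
  have "(\<lambda>n. A * (inverse (fact n) * x ^ n)) \<longlonglongrightarrow> A * 0"
    by (intro tendsto_intros summable_LIMSEQ_zero summable_exp)
  then show ?thesis by (simp add: field_simps)
qed

lemma bounded_on_square:
  fixes f :: "real \<times> real \<Rightarrow> real"
  assumes "continuous_on (I \<times> I) f" "{a..b} \<subseteq> I"
  obtains M where "M \<ge> 0" "\<forall>p \<in> {a..b} \<times> {a..b}. \<bar>f p\<bar> \<le> M"
proof -
  have "continuous_on ({a..b} \<times> {a..b}) f"
    by (rule continuous_on_subset[OF assms(1)]) (use assms(2) in auto)
  then have "bounded (f ` ({a..b} \<times> {a..b}))"
    by (rule compact_imp_bounded[OF compact_continuous_image]) (simp add: compact_Times)
  then obtain M where M: "\<forall>p \<in> {a..b} \<times> {a..b}. \<bar>f p\<bar> \<le> M"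
    by (auto simp: bounded_iff)
  have "\<bar>f p\<bar> \<le> \<bar>M\<bar>" if "p \<in> {a..b} \<times> {a..b}" for p
    using bspec[OF M that] by linarith
  then show ?thesis using that[of "\<bar>M\<bar>"] by simp
qed

lemma segment_in_Icc: "(u::real) \<in> {a..b} \<Longrightarrow> v \<in> {a..b} \<Longrightarrow> s \<in> closed_segment u v \<Longrightarrow> s \<in> {a..b}"
  by (auto simp: closed_segment_eq_real_ivl split: if_splits)

text \<open>Iterating the two integrations from the diagonal bounds a solution by
  \<open>M C^n |x - y|^n / n!\<close> for every \<open>n\<close>.\<close>
lemma diagonal_Cauchy_unique:
  fixes z1 z2 c :: "real \<times> real \<Rightarrow> real"
  assumes I: "open I" "is_interval I"
    and cont: "continuous_on (I \<times> I) z1" "continuous_on (I \<times> I) z2" "continuous_on (I \<times> I) c"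
    and d1: "\<And>x y. x \<in> I \<Longrightarrow> y \<in> I \<Longrightarrow> ((\<lambda>s. z1 (x, s)) has_real_derivative - z2 (x, y)) (at y)"
    and d2: "\<And>x y. x \<in> I \<Longrightarrow> y \<in> I \<Longrightarrow>
        ((\<lambda>s. z2 (s, y)) has_real_derivative - (c (x, y) * z1 (x, y))) (at x)"
    and z: "\<And>t. t \<in> I \<Longrightarrow> z1 (t, t) = 0" "\<And>t. t \<in> I \<Longrightarrow> z2 (t, t) = 0"
    and xy: "x \<in> I" "y \<in> I"
  shows "z1 (x, y) = 0" "z2 (x, y) = 0"
proof -
  obtain a b where ab: "{a..b} \<subseteq> I" "a < x" "x < b" "a < y" "y < b"
    using open_interval_box[OF I xy] .
  obtain M1 where M1: "M1 \<ge> 0" "\<forall>p \<in> {a..b} \<times> {a..b}. \<bar>z1 p\<bar> \<le> M1"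
    using bounded_on_square[OF cont(1) ab(1)] .
  obtain M2 where M2: "M2 \<ge> 0" "\<forall>p \<in> {a..b} \<times> {a..b}. \<bar>z2 p\<bar> \<le> M2"
    using bounded_on_square[OF cont(2) ab(1)] .
  obtain C' where C': "C' \<ge> 0" "\<forall>p \<in> {a..b} \<times> {a..b}. \<bar>c p\<bar> \<le> C'"
    using bounded_on_square[OF cont(3) ab(1)] .
  \<comment> \<open>One bound must serve both components: integrating \<open>z2\<close> costs the
    factor 1 and integrating c z1 costs the factor \<open>C'\<close>, hence the maximum with
    1.\<close>
  define M C where "M = max M1 M2" and "C = max 1 C'"
  have C1: "C \<ge> 1" unfolding C_def by simp
  have C2: "\<bar>c p\<bar> \<le> C" if "p \<in> {a..b} \<times> {a..b}" for p
    using bspec[OF C'(2) that] unfolding C_def by simp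
  have M: "M \<ge> 0" using M1(1) unfolding M_def by simp
  have bound: "\<bar>z1 (u, v)\<bar> \<le> M * C ^ n * \<bar>u - v\<bar> ^ n / fact n \<and>
      \<bar>z2 (u, v)\<bar> \<le> M * C ^ n * \<bar>u - v\<bar> ^ n / fact n"
    if "u \<in> {a..b}" "v \<in> {a..b}" for u v n
    using that
  proof (induction n arbitrary: u v)
    case 0
    then show ?case using bspec[OF M1(2), of "(u, v)"] bspec[OF M2(2), of "(u, v)"] by (auto simp: M_def)
  next
    case (Suc n)
    let ?E = "\<lambda>u v. M * C ^ n * \<bar>u - v\<bar> ^ n / fact n"
    have E: "0 \<le> ?E u v" for u v using M C1 by simp
    have uv: "u \<in> I" "v \<in> I" using Suc.prems ab(1) by auto
    have "\<bar>z1 (u, v)\<bar> \<le> (M * C ^ n * C) * \<bar>v - u\<bar> ^ Suc n / fact (Suc n)"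
    proof (rule factorial_bound_step[where f = "\<lambda>s. z1 (u, s)"])
      fix s assume "s \<in> closed_segment u v"
      then have s: "s \<in> {a..b}" using segment_in_Icc Suc.prems by blast
      then show "((\<lambda>s. z1 (u, s)) has_real_derivative - z2 (u, s)) (at s)"
        using d1 uv ab(1) by blast
      have "\<bar>z2 (u, s)\<bar> \<le> ?E u s" using Suc.IH[OF Suc.prems(1) s] by blast
      also have "\<dots> \<le> ?E u s * C" using mult_left_mono[OF C1 E[of u s]] by simp
      finally show "\<bar>- z2 (u, s)\<bar> \<le> M * C ^ n * C * \<bar>s - u\<bar> ^ n / fact n"
        by (simp add: abs_minus_commute mult_ac)
    qed (use z uv in auto)
    moreover have "\<bar>z2 (u, v)\<bar> \<le> (M * C ^ n * C) * \<bar>u - v\<bar> ^ Suc n / fact (Suc n)"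
    proof (rule factorial_bound_step[where f = "\<lambda>s. z2 (s, v)"])
      fix s assume "s \<in> closed_segment v u"
      then have s: "s \<in> {a..b}" using segment_in_Icc Suc.prems by blast
      then show "((\<lambda>s. z2 (s, v)) has_real_derivative - (c (s, v) * z1 (s, v))) (at s)"
        using d2 uv ab(1) by blast
      have "\<bar>c (s, v)\<bar> * \<bar>z1 (s, v)\<bar> \<le> C * ?E s v"
        using Suc.IH[OF s Suc.prems(2)] C2[of "(s, v)"] s Suc.prems C1
        by (intro mult_mono) auto
      then show "\<bar>- (c (s, v) * z1 (s, v))\<bar> \<le> M * C ^ n * C * \<bar>s - v\<bar> ^ n / fact n"
        by (simp add: abs_mult mult_ac)
    qed (use z uv in auto)
    ultimately show ?case by (simp add: abs_minus_commute mult_ac)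
  qed
  have lim: "(\<lambda>n. M * C ^ n * \<bar>x - y\<bar> ^ n / fact n) \<longlonglongrightarrow> 0"
    using power_over_fact_tendsto_0[of M "C * \<bar>x - y\<bar>"] by (simp add: power_mult_distrib mult_ac)
  have "\<bar>z1 (x, y)\<bar> \<le> 0" "\<bar>z2 (x, y)\<bar> \<le> 0"
    by (rule LIMSEQ_le_const[OF lim]; use bound[of x y] ab in auto)+
  then show "z1 (x, y) = 0" "z2 (x, y) = 0" by auto
qed

section \<open>Integration operators with the diagonal as lower limit\<close>

locale base_interval =
  fixes I :: "real set" and t0 :: real
  assumes I: "open I" "is_interval I" "t0 \<in> I"
begin

text \<open>The integral of f(x, s) ds from s = x to s = y. Splitting it at the fixed point
  \<open>t0\<close> turns the moving lower limit into a composition with (x, y) to (x, x), so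
  regularity follows from that of \<open>antiy\<close>.\<close>

definition inty :: "(real \<times> real \<Rightarrow> real) \<Rightarrow> real \<times> real \<Rightarrow> real" where
  "inty f p = antiy t0 f p - antiy t0 f (fst p, fst p)"

definition intx :: "(real \<times> real \<Rightarrow> real) \<Rightarrow> real \<times> real \<Rightarrow> real" where
  "intx f p = inty (\<lambda>q. f (prod.swap q)) (prod.swap p)"

lemma open_square: "open (I \<times> I)"
  using I(1) by (rule open_Times[OF _ I(1)])

lemma inty_diag: "inty f (t, t) = 0"
  by (simp add: inty_def)

lemma intx_diag: "intx f (t, t) = 0"
  by (simp add: intx_def inty_diag)

lemma Ck_inty: "Ck n (I \<times> I) f \<Longrightarrow> Ck n (I \<times> I) (inty f)"
  unfolding inty_def[abs_def] by (rule Ck_diff[OF Ck_antiy[OF I] Ck_diag_fst[OF Ck_antiy[OF I]]])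

lemma Ck_intx: "Ck n (I \<times> I) f \<Longrightarrow> Ck n (I \<times> I) (intx f)"
  unfolding intx_def[abs_def] by (rule Ck_swap[OF Ck_inty[OF Ck_swap]])

lemma inty_deriv:
  assumes "continuous_on (I \<times> I) f" "x \<in> I" "y \<in> I"
  shows "((\<lambda>s. inty f (x, s)) has_real_derivative f (x, y)) (at y)"
  using DERIV_diff[OF antiy_deriv_y[OF I assms] DERIV_const[of "antiy t0 f (x, x)"]]
  by (simp add: inty_def)

lemma continuous_on_swap_square:
  "continuous_on (I \<times> I) f \<Longrightarrow> continuous_on (I \<times> I) (\<lambda>p. f (prod.swap p))"
  for f :: "real \<times> real \<Rightarrow> real"
  using Ck_swap[of 0 I f] by simp

lemma intx_deriv:
  assumes "continuous_on (I \<times> I) f" "x \<in> I" "y \<in> I"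
  shows "((\<lambda>s. intx f (s, y)) has_real_derivative f (x, y)) (at x)"
  using inty_deriv[OF continuous_on_swap_square[OF assms(1)] assms(3,2)]
  by (simp add: intx_def)

text \<open>The term - f(x, x) in the x-derivative comes from the moving lower limit.\<close>

lemma grad_on_inty:
  assumes c: "continuous_on (I \<times> I) f" "continuous_on (I \<times> I) fx"
    and d: "\<And>x y. x \<in> I \<Longrightarrow> y \<in> I \<Longrightarrow> ((\<lambda>s. f (s, y)) has_real_derivative fx (x, y)) (at x)"
  shows "grad_on (I \<times> I) (inty f) (\<lambda>p. inty fx p - f (fst p, fst p)) f"
proof -
  note g = grad_on_antiy[OF I c d]
  show ?thesis
    by (rule grad_on_cong[OF open_square grad_on_diff[OF g grad_on_diag_fst[OF g]]])
      (auto simp: inty_def)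
qed

lemma grad_on_intx:
  assumes c: "continuous_on (I \<times> I) f" "continuous_on (I \<times> I) fy"
    and d: "\<And>x y. x \<in> I \<Longrightarrow> y \<in> I \<Longrightarrow> ((\<lambda>s. f (x, s)) has_real_derivative fy (x, y)) (at y)"
  shows "grad_on (I \<times> I) (intx f) f (\<lambda>p. intx fy p - f (snd p, snd p))"
proof -
  have "grad_on (I \<times> I) (inty (\<lambda>q. f (prod.swap q)))
      (\<lambda>p. inty (\<lambda>q. fy (prod.swap q)) p - f (prod.swap (fst p, fst p))) (\<lambda>q. f (prod.swap q))"
    by (rule grad_on_inty[OF continuous_on_swap_square[OF c(1)] continuous_on_swap_square[OF c(2)]])
      (use d in simp)
  from grad_on_swap[OF this] show ?thesis
    by (rule grad_on_cong[OF open_square]) (auto simp: intx_def)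
qed

end

section \<open>The Cauchy problem on the diagonal\<close>

text \<open>The Cauchy problem \<open>u_xy = F(x, y, u)\<close>, \<open>u(t,t) = h0 t\<close>, \<open>u_x(t,t) = h1 t\<close>.\<close>

locale diagonal_Cauchy = base_interval +
  fixes F :: "real \<times> real \<Rightarrow> real \<Rightarrow> real" and h0 h0' h1 h1' :: "real \<Rightarrow> real"
  assumes F_Ck: "\<And>n v. Ck n (I \<times> I) v \<Longrightarrow> Ck n (I \<times> I) (\<lambda>p. F p (v p))"
    and F_Lipschitz: "\<And>a b. {a..b} \<subseteq> I \<Longrightarrow>
      \<exists>L\<ge>0. \<forall>p\<in>{a..b} \<times> {a..b}. \<forall>v w. \<bar>F p v - F p w\<bar> \<le> L * \<bar>v - w\<bar>"
    and h0: "Cinf (I \<times> I) (\<lambda>p. h0 (fst p))" and h1: "Cinf (I \<times> I) (\<lambda>p. h1 (fst p))"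
    and h0': "\<And>t. t \<in> I \<Longrightarrow> (h0 has_real_derivative h0' t) (at t)"
    and h1': "\<And>t. t \<in> I \<Longrightarrow> (h1 has_real_derivative h1' t) (at t)"
begin

text \<open>The candidate for u_x: along x = const it starts from h1(x) on the diagonal and
  integrates the prescribed u_xy in y.\<close>

definition K :: "(real \<times> real \<Rightarrow> real) \<Rightarrow> real \<times> real \<Rightarrow> real" where
  "K v p = h1 (fst p) + inty (\<lambda>q. F q (v q)) p"

text \<open>Integrating the candidate for u_x along y = const, from h0(y) on the diagonal, turns the
  Cauchy problem into the fixed point equation T u = u.\<close>

definition T :: "(real \<times> real \<Rightarrow> real) \<Rightarrow> real \<times> real \<Rightarrow> real" where
  "T v p = h0 (snd p) + intx (K v) p"

lemma Ck_snd:
  fixes h :: "real \<Rightarrow> real"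
  assumes "Cinf (I \<times> I) (\<lambda>p. h (fst p))"
  shows "Ck n (I \<times> I) (\<lambda>p. h (snd p))"
  using Ck_swap[of n I "\<lambda>p. h (fst p)"] assms by (simp add: Cinf_def)

lemma Ck_K: "Ck n (I \<times> I) v \<Longrightarrow> Ck n (I \<times> I) (K v)"
  unfolding K_def[abs_def] using h1 by (intro Ck_add Ck_inty F_Ck) (simp add: Cinf_def)

lemma Ck_T: "Ck n (I \<times> I) v \<Longrightarrow> Ck n (I \<times> I) (T v)"
  unfolding T_def[abs_def] by (intro Ck_add Ck_intx Ck_K Ck_snd h0)

lemma K_deriv:
  assumes "continuous_on (I \<times> I) v" "x \<in> I" "y \<in> I"
  shows "((\<lambda>s. K v (x, s)) has_real_derivative F (x, y) (v (x, y))) (at y)"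
  unfolding K_def
  using DERIV_add[OF DERIV_const[of "h1 x"]
      inty_deriv[of "\<lambda>q. F q (v q)", OF _ assms(2,3)]] F_Ck[of 0 v] assms(1)
  by simp

lemma T_deriv:
  assumes "continuous_on (I \<times> I) v" "x \<in> I" "y \<in> I"
  shows "((\<lambda>s. T v (s, y)) has_real_derivative K v (x, y)) (at x)"
  unfolding T_def
  using DERIV_add[OF DERIV_const[of "h0 y"] intx_deriv[of "K v", OF _ assms(2,3)]]
    Ck_K[of 0 v] assms(1)
  by simp

text \<open>\<open>T\<close> integrates twice from the diagonal, so the exponent rises by two and
  the constant only by \<open>L\<close>. The exponent \<open>n\<close> is kept general: powers of |x
  - y| feed the iteration, and \<open>n\<close> = 0 turns a uniform bound into continuity of
  \<open>T\<close>.\<close>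

lemma T_contraction:
  assumes v: "continuous_on (I \<times> I) v" and w: "continuous_on (I \<times> I) w"
    and ab: "{a..b} \<subseteq> I"
    and L: "L \<ge> 0" "\<forall>p\<in>{a..b} \<times> {a..b}. \<forall>v w. \<bar>F p v - F p w\<bar> \<le> L * \<bar>v - w\<bar>"
    and B: "\<And>x y. x \<in> {a..b} \<Longrightarrow> y \<in> {a..b} \<Longrightarrow>
      \<bar>v (x, y) - w (x, y)\<bar> \<le> B * \<bar>x - y\<bar> ^ n / fact n"
    and xy: "x \<in> {a..b}" "y \<in> {a..b}"
  shows "\<bar>T v (x, y) - T w (x, y)\<bar> \<le> L * B * \<bar>x - y\<bar> ^ Suc (Suc n) / fact (Suc (Suc n))"
proof -
  have K: "\<bar>K v (x, y) - K w (x, y)\<bar> \<le> L * B * \<bar>y - x\<bar> ^ Suc n / fact (Suc n)"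
    if "x \<in> {a..b}" "y \<in> {a..b}" for x y
  proof (rule factorial_bound_step[where f = "\<lambda>s. K v (x, s) - K w (x, s)"])
    fix s assume "s \<in> closed_segment x y"
    then have s: "s \<in> {a..b}" using segment_in_Icc that by blast
    then have sI: "x \<in> I" "s \<in> I" using that ab by auto
    show "((\<lambda>s. K v (x, s) - K w (x, s)) has_real_derivative
        F (x, s) (v (x, s)) - F (x, s) (w (x, s))) (at s)"
      by (intro DERIV_diff K_deriv v w sI)
    have "\<bar>F (x, s) (v (x, s)) - F (x, s) (w (x, s))\<bar> \<le> L * \<bar>v (x, s) - w (x, s)\<bar>"
      using L(2) s that by auto
    also have "\<dots> \<le> L * (B * \<bar>x - s\<bar> ^ n / fact n)"
      by (rule mult_left_mono[OF B[OF that(1) s] L(1)])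
    finally show "\<bar>F (x, s) (v (x, s)) - F (x, s) (w (x, s))\<bar> \<le> L * B * \<bar>s - x\<bar> ^ n / fact n"
      by (simp add: abs_minus_commute mult.assoc)
  qed (simp add: K_def inty_diag)
  show ?thesis
  proof (rule factorial_bound_step[where f = "\<lambda>s. T v (s, y) - T w (s, y)"])
    fix s assume "s \<in> closed_segment y x"
    then have s: "s \<in> {a..b}" using segment_in_Icc xy by blast
    then have sI: "s \<in> I" "y \<in> I" using xy ab by auto
    show "((\<lambda>s. T v (s, y) - T w (s, y)) has_real_derivative K v (s, y) - K w (s, y)) (at s)"
      by (intro DERIV_diff T_deriv v w sI)
    show "\<bar>K v (s, y) - K w (s, y)\<bar> \<le> L * B * \<bar>s - y\<bar> ^ Suc n / fact (Suc n)"
      using K[OF s xy(2)] by (simp add: abs_minus_commute)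
  qed (simp add: T_def intx_diag)
qed

section \<open>Picard iteration and its limit\<close>

definition iter :: "nat \<Rightarrow> real \<times> real \<Rightarrow> real" where
  "iter n = (T ^^ n) (\<lambda>_. 0)"

lemma iter_Suc: "iter (Suc n) = T (iter n)"
  by (simp add: iter_def)

lemma continuous_on_iter: "continuous_on (I \<times> I) (iter n)"
proof (induction n)
  case (Suc n)
  then show ?case using Ck_T[of 0 "iter n"] by (simp add: iter_Suc)
qed (simp add: iter_def continuous_on_const)

text \<open>The limit is written as a telescoping series, the form that the Weierstrass M-test
  needs. No constant term appears because \<open>iter 0\<close> is zero.\<close>

definition sol :: "real \<times> real \<Rightarrow> real" where
  "sol p = (\<Sum>i. iter (Suc i) p - iter i p)"

lemma iter_uniform_limit:
  assumes ab: "{a..b} \<subseteq> I"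
  shows "uniform_limit ({a..b} \<times> {a..b}) iter sol sequentially"
proof -
  let ?S = "{a..b} \<times> {a..b}"
  obtain L where L: "L \<ge> 0" "\<forall>p\<in>?S. \<forall>v w. \<bar>F p v - F p w\<bar> \<le> L * \<bar>v - w\<bar>"
    using F_Lipschitz[OF ab] by blast
  obtain M where M: "M \<ge> 0" "\<forall>p \<in> ?S. \<bar>iter (Suc 0) p\<bar> \<le> M"
    using bounded_on_square[OF continuous_on_iter ab] .
  have step: "\<bar>iter (Suc n) (x, y) - iter n (x, y)\<bar> \<le> L ^ n * M * \<bar>x - y\<bar> ^ (2 * n) / fact (2 * n)"
    if "x \<in> {a..b}" "y \<in> {a..b}" for n x y
    using that
  proof (induction n arbitrary: x y)
    case 0
    then show ?case using bspec[OF M(2), of "(x, y)"] by (simp add: iter_def)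
  next
    case (Suc n)
    from T_contraction[OF continuous_on_iter continuous_on_iter ab L Suc.IH Suc.prems]
    show ?case by (simp add: iter_Suc mult.assoc)
  qed
  \<comment> \<open>Weakening (2n)! to n! makes the majorant a multiple of an exponential series,
    which converges however large \<open>L\<close> and b - a are; this is why no smallness of the
    square is required.\<close>
  let ?M = "\<lambda>n. M * (L * (b - a)\<^sup>2) ^ n / fact n"
  have sm: "summable ?M"
    using summable_mult[OF summable_exp[of "L * (b - a)\<^sup>2"], of M] by (simp add: field_simps)
  have "norm (iter (Suc n) p - iter n p) \<le> ?M n" if p: "p \<in> ?S" for n p
  proof -
    obtain x y where xy: "p = (x, y)" "x \<in> {a..b}" "y \<in> {a..b}" using p by auto
    have d: "\<bar>x - y\<bar> \<le> b - a" using xy by auto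
    have "\<bar>x - y\<bar> ^ (2 * n) / fact (2 * n) \<le> (b - a) ^ (2 * n) / fact n"
      by (intro frac_le power_mono d fact_mono) (use d in auto)
    from mult_left_mono[OF this, of "L ^ n * M"]
    have "L ^ n * M * \<bar>x - y\<bar> ^ (2 * n) / fact (2 * n) \<le> L ^ n * M * (b - a) ^ (2 * n) / fact n"
      using L(1) M(1) by simp
    then show ?thesis
      using step[OF xy(2,3), of n]
      by (simp add: xy(1) power_mult[symmetric] power_mult_distrib mult_ac)
  qed
  then have "uniform_limit ?S (\<lambda>n p. \<Sum>i<n. iter (Suc i) p - iter i p) sol sequentially"
    unfolding sol_def[abs_def] by (rule Weierstrass_m_test[OF _ sm])
  moreover have "(\<Sum>i<n. iter (Suc i) p - iter i p) = iter n p" for n p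
    using sum_lessThan_telescope[of "\<lambda>i. iter i p" n] by (simp add: iter_def)
  ultimately show ?thesis by simp
qed

lemma continuous_on_sol: "continuous_on (I \<times> I) sol"
proof (rule continuous_at_imp_continuous_on, rule ballI)
  fix p assume "p \<in> I \<times> I"
  then obtain x y where p: "p = (x, y)" "x \<in> I" "y \<in> I" by auto
  obtain a b where ab: "{a..b} \<subseteq> I" "a < x" "x < b" "a < y" "y < b"
    using open_interval_box[OF I(1,2) p(2,3)] .
  have "continuous_on ({a..b} \<times> {a..b}) sol"
  proof (rule uniform_limit_theorem[OF _ iter_uniform_limit[OF ab(1)]])
    show "\<forall>\<^sub>F n in sequentially. continuous_on ({a..b} \<times> {a..b}) (iter n)"
      by (intro always_eventually allI continuous_on_subset[OF continuous_on_iter])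
        (use ab(1) in auto)
  qed simp
  then have "continuous_on ({a<..<b} \<times> {a<..<b}) sol"
    by (rule continuous_on_subset) auto
  moreover have "open ({a<..<b} \<times> {a<..<b})" by (intro open_Times open_greaterThanLessThan)
  ultimately show "isCont sol p"
    using continuous_on_eq_continuous_at[of "{a<..<b} \<times> {a<..<b}" sol] ab p(1) by auto
qed

lemma T_sol:
  assumes "p \<in> I \<times> I"
  shows "T sol p = sol p"
proof -
  obtain x y where p: "p = (x, y)" "x \<in> I" "y \<in> I" using assms by auto
  obtain a b where ab: "{a..b} \<subseteq> I" "a < x" "x < b" "a < y" "y < b"
    using open_interval_box[OF I(1,2) p(2,3)] .
  let ?S = "{a..b} \<times> {a..b}"
  obtain L where L: "L \<ge> 0" "\<forall>p\<in>?S. \<forall>v w. \<bar>F p v - F p w\<bar> \<le> L * \<bar>v - w\<bar>"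
    using F_Lipschitz[OF ab(1)] by blast
  have pS: "p \<in> ?S" using p ab by auto
  have "(\<lambda>n. iter n p) \<longlonglongrightarrow> sol p"
    by (rule tendsto_uniform_limitI[OF iter_uniform_limit[OF ab(1)] pS])
  then have 1: "(\<lambda>n. T (iter n) p) \<longlonglongrightarrow> sol p"
    using LIMSEQ_Suc[of "\<lambda>n. iter n p"] by (simp add: iter_Suc)
  have 2: "(\<lambda>n. T (iter n) p) \<longlonglongrightarrow> T sol p"
  proof (rule tendstoI)
    fix e :: real assume e: "e > 0"
    \<comment> \<open>An error e / C in the iterate becomes at most L (e / C) |x - y|^2 / 2 = (C -
      1) (e / C) after applying \<open>T\<close>. The summand 1 makes \<open>C\<close> positive and
      the final bound strictly less than \<open>e\<close>.\<close>
    define C where "C = L * \<bar>x - y\<bar>\<^sup>2 / 2 + 1"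
    have C: "C > 0" using L(1) by (simp add: C_def add_nonneg_pos)
    have "\<forall>\<^sub>F n in sequentially. \<forall>q\<in>?S. dist (iter n q) (sol q) < e / C"
      by (rule uniform_limitD[OF iter_uniform_limit[OF ab(1)]]) (use e C in simp)
    then show "\<forall>\<^sub>F n in sequentially. dist (T (iter n) p) (T sol p) < e"
    proof (rule eventually_mono)
      fix n assume n: "\<forall>q\<in>?S. dist (iter n q) (sol q) < e / C"
      have "\<bar>T (iter n) (x, y) - T sol (x, y)\<bar>
          \<le> L * (e / C) * \<bar>x - y\<bar> ^ Suc (Suc 0) / fact (Suc (Suc 0))"
      proof (rule T_contraction[OF continuous_on_iter continuous_on_sol ab(1) L])
        fix x y assume "x \<in> {a..b}" "y \<in> {a..b}"
        then have "dist (iter n (x, y)) (sol (x, y)) < e / C" using n by simp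
        then show "\<bar>iter n (x, y) - sol (x, y)\<bar> \<le> e / C * \<bar>x - y\<bar> ^ 0 / fact 0"
          by (simp add: dist_real_def)
      qed (use ab in auto)
      also have "\<dots> = (C - 1) * (e / C)" by (simp add: C_def power2_eq_square)
      also have "\<dots> < C * (e / C)" using e C by (intro mult_strict_right_mono) auto
      finally show "dist (T (iter n) p) (T sol p) < e" using C by (simp add: p(1) dist_real_def)
    qed
  qed
  show ?thesis by (rule LIMSEQ_unique[OF 2 1])
qed

section \<open>Derivatives and smoothness of the solution\<close>

definition solx :: "real \<times> real \<Rightarrow> real" where
  "solx = K sol"

text \<open>Differentiating the fixed point equation in y yields the boundary term - K sol (y, y),
  which equals - h1(y).\<close>

definition soly :: "real \<times> real \<Rightarrow> real" where
  "soly p = h0' (snd p) - h1 (snd p) + intx (\<lambda>q. F q (sol q)) p"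

lemma grad_on_sol: "grad_on (I \<times> I) sol solx soly"
proof -
  have cF: "continuous_on (I \<times> I) (\<lambda>q. F q (sol q))" using F_Ck[of 0 sol] continuous_on_sol by simp
  have cK: "continuous_on (I \<times> I) (K sol)" using Ck_K[of 0 sol] continuous_on_sol by simp
  have g0: "grad_on (I \<times> I) (\<lambda>p. h0 (snd p)) (\<lambda>p. 0) (\<lambda>p. h0' (snd p))"
    using grad_on_swap[OF grad_on_fst[of I h0 h0', OF h0']] by simp
  have g1: "grad_on (I \<times> I) (intx (K sol)) (K sol)
      (\<lambda>p. intx (\<lambda>q. F q (sol q)) p - K sol (snd p, snd p))"
    by (rule grad_on_intx[OF cK cF K_deriv[OF continuous_on_sol]])
  show ?thesis
    by (rule grad_on_cong[OF open_square grad_on_add[OF g0 g1]])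
      (use T_sol in \<open>auto simp: T_def solx_def soly_def K_def inty_diag\<close>)
qed

lemma Cinf_h0': "Cinf (I \<times> I) (\<lambda>p. h0' (fst p))"
  using Cinf_grad[OF open_square grad_on_fst[of I h0 h0', OF h0']] h0 by blast

text \<open>Bootstrap: both partial derivatives are integrals of expressions in \<open>sol\<close>
  plus smooth data, so they are as regular as \<open>sol\<close>, which therefore gains one order at
  each round.\<close>

lemma Cinf_sol: "Cinf (I \<times> I) sol"
proof -
  have "Ck n (I \<times> I) sol" for n
  proof (induction n)
    case 0
    then show ?case using continuous_on_sol by simp
  next
    case (Suc n)
    show ?case
    proof (rule Ck_SucI[OF grad_on_sol])
      show "Ck n (I \<times> I) solx" unfolding solx_def by (rule Ck_K[OF Suc])
      show "Ck n (I \<times> I) soly"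
        unfolding soly_def[abs_def] by (intro Ck_add Ck_diff Ck_intx F_Ck Suc Ck_snd Cinf_h0' h1)
    qed
  qed
  then show ?thesis by (simp add: Cinf_def)
qed

lemma Cinf_F_sol: "Cinf (I \<times> I) (\<lambda>p. F p (sol p))"
  using Cinf_sol F_Ck unfolding Cinf_def by blast

text \<open>Here k = u_x, l = u_y and m = u_xx. The claims m_y = F_x and l_x = F are read off from
  integral formulas, in place of a theorem on the symmetry of mixed derivatives. The first is stated
  for an arbitrary gradient of the right-hand side, so that a caller can insert its own product
  rule.\<close>

lemma sol_exists:
  obtains u k l m where
    "Cinf (I \<times> I) u"
    "grad_on (I \<times> I) u k l"
    "grad_on (I \<times> I) k m (\<lambda>p. F p (u p))"
    "\<And>fx fy x y. grad_on (I \<times> I) (\<lambda>p. F p (u p)) fx fy \<Longrightarrow> x \<in> I \<Longrightarrow> y \<in> I \<Longrightarrow>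
      ((\<lambda>s. m (x, s)) has_real_derivative fx (x, y)) (at y)"
    "\<And>x y. x \<in> I \<Longrightarrow> y \<in> I \<Longrightarrow> ((\<lambda>s. l (s, y)) has_real_derivative F (x, y) (u (x, y))) (at x)"
    "\<And>t. t \<in> I \<Longrightarrow> u (t, t) = h0 t"
    "\<And>t. t \<in> I \<Longrightarrow> k (t, t) = h1 t"
    "\<And>t. t \<in> I \<Longrightarrow> l (t, t) = h0' t - h1 t"
    "\<And>t. t \<in> I \<Longrightarrow> m (t, t) = h1' t - F (t, t) (h0 t)"
proof -
  obtain fx fy where f: "grad_on (I \<times> I) (\<lambda>p. F p (sol p)) fx fy" "Cinf (I \<times> I) fx"
    using Cinf_obtain_grad[OF open_square Cinf_F_sol] .
  have cF: "continuous_on (I \<times> I) (\<lambda>q. F q (sol q))" and cfx: "continuous_on (I \<times> I) fx"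
    using Cinf_F_sol f(2) Cinf_continuous by blast+
  have diag: "sol (t, t) = h0 t" if "t \<in> I" for t
    using T_sol[of "(t, t)"] that by (simp add: T_def intx_diag)
  define m where "m p = h1' (fst p) + (inty fx p - F (fst p, fst p) (sol (fst p, fst p)))" for p
  show ?thesis
  proof (rule that[OF Cinf_sol grad_on_sol, of m])
    have "grad_on (I \<times> I) (inty (\<lambda>q. F q (sol q)))
        (\<lambda>p. inty fx p - F (fst p, fst p) (sol (fst p, fst p))) (\<lambda>q. F q (sol q))"
      by (rule grad_on_inty[OF cF cfx grad_on_real_derivative(1)[OF f(1)]])
    from grad_on_add[OF grad_on_fst[of I h1 h1', OF h1'] this]
    show "grad_on (I \<times> I) solx m (\<lambda>p. F p (sol p))"
      by (rule grad_on_cong[OF open_square]) (auto simp: solx_def K_def m_def)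
    show "((\<lambda>s. m (x, s)) has_real_derivative gx (x, y)) (at y)"
      if g: "grad_on (I \<times> I) (\<lambda>p. F p (sol p)) gx gy" and xy: "x \<in> I" "y \<in> I" for gx gy x y
    proof -
      have "((\<lambda>s. m (x, s)) has_real_derivative 0 + (fx (x, y) - 0)) (at y)"
        unfolding m_def fst_conv by (intro DERIV_add DERIV_diff DERIV_const inty_deriv cfx xy)
      then show ?thesis using grad_on_unique(1)[OF f(1) g, of "(x, y)"] xy by simp
    qed
    show "((\<lambda>s. soly (s, y)) has_real_derivative F (x, y) (sol (x, y))) (at x)"
      if xy: "x \<in> I" "y \<in> I" for x y
    proof -
      have "((\<lambda>s. soly (s, y)) has_real_derivative 0 + F (x, y) (sol (x, y))) (at x)"
        unfolding soly_def snd_conv by (intro DERIV_add DERIV_const intx_deriv[OF cF] xy)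
      then show ?thesis by simp
    qed
  qed (simp_all add: diag m_def solx_def soly_def K_def inty_diag intx_diag)
qed

end

section \<open>Real analytic functions\<close>

text \<open>A power series may be differentiated term by term within its radius, so the same radius
  with the coefficients \<open>diffs c\<close> represents the derivative.\<close>

lemma real_analytic_on_deriv:
  fixes f :: "real \<Rightarrow> real"
  assumes "real_analytic_on f S"
  shows "t \<in> S \<Longrightarrow> (f has_real_derivative deriv f t) (at t)"
    and "real_analytic_on (deriv f) S"
proof -
  have series: "\<exists>r>0. \<exists>c. \<forall>t. \<bar>t - u\<bar> < r \<longrightarrow>
      (f has_real_derivative deriv f t) (at t) \<and> (\<lambda>n. (t - u) ^ n *\<^sub>R c n) sums deriv f t"
    if "u \<in> S" for u
  proof -
    obtain r c where r: "r > 0" and c: "\<And>t. \<bar>t - u\<bar> < r \<Longrightarrow> (\<lambda>n. (t - u) ^ n *\<^sub>R c n) sums f t"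
      using assms \<open>u \<in> S\<close> unfolding real_analytic_on_def by blast
    have sum: "summable (\<lambda>n. c n * h ^ n)" if "norm h < r" for h
      using c[of "u + h"] that by (auto simp: mult.commute sums_iff)
    have f: "f t = (\<Sum>n. c n * (t - u) ^ n)" if "\<bar>t - u\<bar> < r" for t
      using c[OF that] by (auto simp: mult.commute sums_iff)
    have D: "(f has_real_derivative (\<Sum>n. diffs c n * (t - u) ^ n)) (at t)" if t: "\<bar>t - u\<bar> < r" for t
    proof -
      have "((\<lambda>h. \<Sum>n. c n * h ^ n) has_real_derivative (\<Sum>n. diffs c n * (t - u) ^ n)) (at (t - u))"
        using termdiffs_strong'[OF sum] t by simp
      then have "((\<lambda>t. \<Sum>n. c n * (t - u) ^ n) has_real_derivative (\<Sum>n. diffs c n * (t - u) ^ n)) (at t)"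
        using DERIV_shift[of "\<lambda>h. \<Sum>n. c n * h ^ n" _ t "- u"] by simp
      then show ?thesis
        by (rule has_field_derivative_transform_within_open[of _ _ _ "ball u r"])
          (use t f in \<open>auto simp: dist_real_def abs_minus_commute\<close>)
    qed
    have "(f has_real_derivative deriv f t) (at t) \<and> (\<lambda>n. (t - u) ^ n *\<^sub>R diffs c n) sums deriv f t"
      if t: "\<bar>t - u\<bar> < r" for t
    proof -
      have "summable (\<lambda>n. diffs c n * (t - u) ^ n)"
        using termdiff_converges[of "t - u" r c] sum t by simp
      then show ?thesis using D[OF t] DERIV_imp_deriv[OF D[OF t]]
        by (simp add: mult.commute summable_sums)
    qed
    then show ?thesis using r by blast
  qed
  show "(f has_real_derivative deriv f t) (at t)" if "t \<in> S" for t
    using series[OF that] by force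
  show "real_analytic_on (deriv f) S"
    using series unfolding real_analytic_on_def by blast
qed

text \<open>Analyticity passes to the derivative, so the induction on the order moves from
  \<open>f\<close> to \<open>deriv f\<close>.\<close>

lemma real_analytic_on_Cinf:
  fixes f :: "real \<Rightarrow> real"
  assumes "real_analytic_on f I"
  shows "Cinf (I \<times> I) (\<lambda>p. f (fst p))"
proof -
  have "Ck n (I \<times> I) (\<lambda>p. f (fst p))" for n
    using assms
  proof (induction n arbitrary: f)
    case 0
    then show ?case
      using grad_on_continuous[OF grad_on_fst[of I f "deriv f"]] real_analytic_on_deriv(1) by simp
  next
    case (Suc n)
    show ?case
      by (rule Ck_SucI[OF grad_on_fst[of I f "deriv f", OF real_analytic_on_deriv(1)[OF Suc.prems]]
            Suc.IH[OF real_analytic_on_deriv(2)[OF Suc.prems]] Ck_const])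
  qed
  then show ?thesis by (simp add: Cinf_def)
qed

lemma real_analytic_on_entry:
  fixes N :: "real \<Rightarrow> real^'n^'m"
  assumes "real_analytic_on N S"
  shows "real_analytic_on (\<lambda>t. N t $ i $ j) S"
proof -
  have "bounded_linear (\<lambda>X::real^'n^'m. X $ i $ j)"
    by (rule bounded_linear_compose[OF bounded_linear_vec_nth bounded_linear_vec_nth])
  from bounded_linear.sums[OF this]
  have "(\<lambda>n. (h ^ n *\<^sub>R c n) $ i $ j) sums (N t $ i $ j)"
    if "(\<lambda>n. h ^ n *\<^sub>R c n) sums N t" for h t and c :: "nat \<Rightarrow> real^'n^'m"
    using that .
  then show ?thesis
    using assms unfolding real_analytic_on_def vector_scaleR_component by meson
qed

lemma zero_derivative_zero:
  fixes f :: "real \<Rightarrow> real"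
  assumes "f a = 0" and "\<And>s. s \<in> closed_segment a b \<Longrightarrow> (f has_real_derivative 0) (at s)"
  shows "f b = 0"
  using factorial_bound_step[of f a b "\<lambda>_. 0" 0 0] assms by simp

lemma abs_sin_diff_le: "\<bar>sin v - sin w\<bar> \<le> \<bar>v - w\<bar>" for v w :: real
proof -
  have "((\<lambda>s. sin s - sin w) has_real_derivative cos s) (at s)" for s
    by (auto intro!: derivative_eq_intros)
  from factorial_bound_step[OF _ this, of w v 1 0] show ?thesis by simp
qed

lemma abs_cos_diff_le: "\<bar>cos v - cos w\<bar> \<le> \<bar>v - w\<bar>" for v w :: real
proof -
  have "((\<lambda>s. cos s - cos w) has_real_derivative - sin s) (at s)" for s
    by (auto intro!: derivative_eq_intros)
  from factorial_bound_step[OF _ this, of w v 1 0] show ?thesis by simp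
qed

section \<open>The structure functions and the moving frame\<close>

context base_interval
begin

lemma segment_in_I: "u \<in> I \<Longrightarrow> v \<in> I \<Longrightarrow> s \<in> closed_segment u v \<Longrightarrow> s \<in> I"
  using I(2) closed_segment_subset is_interval_convex by blast

lemma Cinf_fst_deriv:
  fixes h :: "real \<Rightarrow> real"
  assumes "Cinf (I \<times> I) (\<lambda>p. h (fst p))" "t \<in> I"
  shows "(h has_real_derivative deriv h t) (at t)"
proof -
  obtain hx hy where "grad_on (I \<times> I) (\<lambda>p. h (fst p)) hx hy"
    using Cinf_obtain_grad[OF open_square assms(1)] .
  from grad_on_real_derivative(1)[OF this assms(2,2)]
  show ?thesis using DERIV_imp_deriv by fastforce
qed

lemma Cinf_snd:
  fixes h :: "real \<Rightarrow> real"
  assumes "Cinf (I \<times> I) (\<lambda>p. h (fst p))"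
  shows "Cinf (I \<times> I) (\<lambda>p. h (snd p))"
  using Ck_swap[of _ I "\<lambda>p. h (fst p)"] assms by (simp add: Cinf_def)

lemma Ck_of_Cinf: "Cinf S f \<Longrightarrow> Ck n S f"
  by (simp add: Cinf_def)

text \<open>Only the angle is obtained by solving an equation. Then \<open>c\<close> and
  \<open>d\<close> are the rotated initial pair, k is the x-derivative of the angle, and the three
  structure equations reduce to differentiation.\<close>

lemma structure_equations_exist:
  fixes c0 d0 k0 :: "real \<Rightarrow> real"
  assumes c0: "Cinf (I \<times> I) (\<lambda>p. c0 (fst p))"
    and d0: "Cinf (I \<times> I) (\<lambda>p. d0 (fst p))"
    and k0: "Cinf (I \<times> I) (\<lambda>p. k0 (fst p))"
  obtains c d k cy dy kx where
    "Cinf (I \<times> I) c" "Cinf (I \<times> I) d" "Cinf (I \<times> I) k"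
    "grad_on (I \<times> I) c (\<lambda>p. k p * d p) cy"
    "grad_on (I \<times> I) d (\<lambda>p. - (k p * c p)) dy"
    "grad_on (I \<times> I) k kx (\<lambda>p. - d p)"
    "\<And>t. t \<in> I \<Longrightarrow> c (t, t) = c0 t" "\<And>t. t \<in> I \<Longrightarrow> d (t, t) = d0 t" "\<And>t. t \<in> I \<Longrightarrow> k (t, t) = k0 t"
proof -
  let ?F = "\<lambda>p v. c0 (snd p) * sin v - d0 (snd p) * cos v"
  note c = Cinf_snd[OF c0] and d = Cinf_snd[OF d0]
  interpret diagonal_Cauchy I t0 ?F "\<lambda>_. 0" "\<lambda>_. 0" k0 "deriv k0"
  proof unfold_locales
    show "Ck n (I \<times> I) (\<lambda>p. ?F p (v p))" if "Ck n (I \<times> I) v" for n v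
      using Ck_sin_cos[OF that] Ck_of_Cinf[OF c] Ck_of_Cinf[OF d] by (intro Ck_diff Ck_mult) auto
    show "\<exists>L\<ge>0. \<forall>p\<in>{a..b} \<times> {a..b}. \<forall>v w. \<bar>?F p v - ?F p w\<bar> \<le> L * \<bar>v - w\<bar>"
      if ab: "{a..b} \<subseteq> I" for a b
    proof -
      obtain A where A: "A \<ge> 0" "\<forall>p \<in> {a..b} \<times> {a..b}. \<bar>c0 (snd p)\<bar> \<le> A"
        using bounded_on_square[OF Cinf_continuous[OF c] ab] .
      obtain B where B: "B \<ge> 0" "\<forall>p \<in> {a..b} \<times> {a..b}. \<bar>d0 (snd p)\<bar> \<le> B"
        using bounded_on_square[OF Cinf_continuous[OF d] ab] .
      have "\<bar>?F p v - ?F p w\<bar> \<le> (A + B) * \<bar>v - w\<bar>" if p: "p \<in> {a..b} \<times> {a..b}" for p v w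
      proof -
        have "?F p v - ?F p w = c0 (snd p) * (sin v - sin w) - d0 (snd p) * (cos v - cos w)"
          by (simp add: algebra_simps)
        also have "\<bar>\<dots>\<bar> \<le> \<bar>c0 (snd p)\<bar> * \<bar>sin v - sin w\<bar> + \<bar>d0 (snd p)\<bar> * \<bar>cos v - cos w\<bar>"
          by (metis abs_mult abs_triangle_ineq4)
        also have "\<dots> \<le> A * \<bar>v - w\<bar> + B * \<bar>v - w\<bar>"
          using bspec[OF A(2) p] bspec[OF B(2) p] A(1) B(1)
          by (intro add_mono mult_mono abs_sin_diff_le abs_cos_diff_le) auto
        finally show ?thesis by (simp add: algebra_simps)
      qed
      then show ?thesis using A(1) B(1) by (intro exI[of _ "A + B"]) auto
    qed
    show "Cinf (I \<times> I) (\<lambda>p. 0::real)" by (rule Cinf_algebra(1))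
    show "Cinf (I \<times> I) (\<lambda>p. k0 (fst p))" by (rule k0)
    show "((\<lambda>_. 0) has_real_derivative 0) (at t)" for t :: real by (rule DERIV_const)
    show "(k0 has_real_derivative deriv k0 t) (at t)" if "t \<in> I" for t
      by (rule Cinf_fst_deriv[OF k0 that])
  qed
  obtain \<phi> k l m where \<phi>: "Cinf (I \<times> I) \<phi>" "grad_on (I \<times> I) \<phi> k l"
    "grad_on (I \<times> I) k m (\<lambda>p. ?F p (\<phi> p))"
    "\<And>t. t \<in> I \<Longrightarrow> \<phi> (t, t) = 0" "\<And>t. t \<in> I \<Longrightarrow> k (t, t) = k0 t"
    by (rule sol_exists) blast
  define c' d' where "c' p = c0 (snd p) * cos (\<phi> p) + d0 (snd p) * sin (\<phi> p)"
    and "d' p = d0 (snd p) * cos (\<phi> p) - c0 (snd p) * sin (\<phi> p)" for p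
  have snd: "grad_on (I \<times> I) (\<lambda>p. h (snd p)) (\<lambda>p. 0) (\<lambda>p. deriv h (snd p))"
    if "Cinf (I \<times> I) (\<lambda>p. h (fst p))" for h :: "real \<Rightarrow> real"
    using grad_on_swap[OF grad_on_fst[of I h "deriv h", OF Cinf_fst_deriv[OF that]]] by simp
  note g = grad_on_mult[OF snd[OF c0] grad_on_cos[OF \<phi>(2)]]
    grad_on_mult[OF snd[OF d0] grad_on_sin[OF \<phi>(2)]]
    grad_on_mult[OF snd[OF d0] grad_on_cos[OF \<phi>(2)]]
    grad_on_mult[OF snd[OF c0] grad_on_sin[OF \<phi>(2)]]
  show ?thesis
  proof (rule that)
    show "Cinf (I \<times> I) c'" "Cinf (I \<times> I) d'"
      unfolding c'_def[abs_def] d'_def[abs_def]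
      by (intro Cinf_algebra Cinf_mult c d Cinf_sin_cos \<phi>(1))+
    show "Cinf (I \<times> I) k" using Cinf_grad[OF open_square \<phi>(2)] \<phi>(1) by blast
    show "grad_on (I \<times> I) c' (\<lambda>p. k p * d' p)
        (\<lambda>p. deriv c0 (snd p) * cos (\<phi> p) + c0 (snd p) * (- sin (\<phi> p) * l p) +
          (deriv d0 (snd p) * sin (\<phi> p) + d0 (snd p) * (cos (\<phi> p) * l p)))"
      by (rule grad_on_cong[OF open_square grad_on_add[OF g(1,2)]])
        (auto simp: c'_def d'_def algebra_simps)
    show "grad_on (I \<times> I) d' (\<lambda>p. - (k p * c' p))
        (\<lambda>p. deriv d0 (snd p) * cos (\<phi> p) + d0 (snd p) * (- sin (\<phi> p) * l p) -
          (deriv c0 (snd p) * sin (\<phi> p) + c0 (snd p) * (cos (\<phi> p) * l p)))"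
      by (rule grad_on_cong[OF open_square grad_on_diff[OF g(3,4)]])
        (auto simp: c'_def d'_def algebra_simps)
    show "grad_on (I \<times> I) k m (\<lambda>p. - d' p)"
      by (rule grad_on_cong[OF open_square \<phi>(3)]) (auto simp: d'_def)
  qed (use \<phi>(4,5) in \<open>auto simp: c'_def d'_def\<close>)
qed

text \<open>Solves for one matrix entry of the frame. The hypotheses on \<open>n0\<close>,
  \<open>n1\<close>, \<open>n2\<close> are the sums of the x- and y-equations of the frame along the
  diagonal. The full overdetermined system is not solved at once: part of it serves as construction,
  and the rest is shown to propagate from the diagonal.\<close>

lemma frame_component_exists:
  fixes c d k :: "real \<times> real \<Rightarrow> real" and n0 n1 n2 :: "real \<Rightarrow> real"
  assumes C: "Cinf (I \<times> I) c" "Cinf (I \<times> I) d" "Cinf (I \<times> I) k"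
    and gc: "grad_on (I \<times> I) c (\<lambda>p. k p * d p) cy"
    and gd: "grad_on (I \<times> I) d (\<lambda>p. - (k p * c p)) dy"
    and gk: "grad_on (I \<times> I) k kx (\<lambda>p. - d p)"
    and n: "Cinf (I \<times> I) (\<lambda>p. n0 (fst p))" "Cinf (I \<times> I) (\<lambda>p. n1 (fst p))"
    and d0: "\<And>t. t \<in> I \<Longrightarrow>
      (n0 has_real_derivative (1 + c (t, t)) * n1 t + d (t, t) * n2 t) (at t)"
    and d1: "\<And>t. t \<in> I \<Longrightarrow>
      (n1 has_real_derivative (1 + c (t, t)) * n0 t + k (t, t) * n2 t) (at t)"
    and d2: "\<And>t. t \<in> I \<Longrightarrow>
      (n2 has_real_derivative d (t, t) * n0 t - k (t, t) * n1 t) (at t)"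
  obtains v e f l where
    "Cinf (I \<times> I) v"
    "grad_on (I \<times> I) v e l"
    "grad_on (I \<times> I) e (\<lambda>p. v p + k p * f p) (\<lambda>p. c p * v p)"
    "grad_on (I \<times> I) f (\<lambda>p. - (k p * e p)) (\<lambda>p. d p * v p)"
    "\<And>t. t \<in> I \<Longrightarrow> v (t, t) = n0 t" "\<And>t. t \<in> I \<Longrightarrow> e (t, t) = n1 t" "\<And>t. t \<in> I \<Longrightarrow> f (t, t) = n2 t"
proof -
  let ?n0' = "\<lambda>t. (1 + c (t, t)) * n1 t + d (t, t) * n2 t"
  let ?n1' = "\<lambda>t. (1 + c (t, t)) * n0 t + k (t, t) * n2 t"
  let ?n2' = "\<lambda>t. d (t, t) * n0 t - k (t, t) * n1 t"
  interpret diagonal_Cauchy I t0 "\<lambda>p v. c p * v" n0 ?n0' n1 ?n1'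
  proof unfold_locales
    show "Ck n (I \<times> I) (\<lambda>p. c p * v p)" if "Ck n (I \<times> I) v" for n v
      by (rule Ck_mult[OF Ck_of_Cinf[OF C(1)] that])
    show "\<exists>L\<ge>0. \<forall>p\<in>{a..b} \<times> {a..b}. \<forall>v w. \<bar>c p * v - c p * w\<bar> \<le> L * \<bar>v - w\<bar>"
      if ab: "{a..b} \<subseteq> I" for a b
    proof -
      obtain A where A: "A \<ge> 0" "\<forall>p \<in> {a..b} \<times> {a..b}. \<bar>c p\<bar> \<le> A"
        using bounded_on_square[OF Cinf_continuous[OF C(1)] ab] .
      have "\<bar>c p * v - c p * w\<bar> \<le> A * \<bar>v - w\<bar>" if "p \<in> {a..b} \<times> {a..b}" for p v w
        using mult_right_mono[OF bspec[OF A(2) that], of "\<bar>v - w\<bar>"]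
        by (simp add: abs_mult[symmetric] right_diff_distrib)
      then show ?thesis using A(1) by blast
    qed
  qed (use n d0 d1 in auto)
  obtain v e l m where v: "Cinf (I \<times> I) v" and gv: "grad_on (I \<times> I) v e l"
    and ge: "grad_on (I \<times> I) e m (\<lambda>p. c p * v p)"
    and my: "\<And>fx fy x y. grad_on (I \<times> I) (\<lambda>p. c p * v p) fx fy \<Longrightarrow> x \<in> I \<Longrightarrow> y \<in> I \<Longrightarrow>
      ((\<lambda>s. m (x, s)) has_real_derivative fx (x, y)) (at y)"
    and lx: "\<And>x y. x \<in> I \<Longrightarrow> y \<in> I \<Longrightarrow> ((\<lambda>s. l (s, y)) has_real_derivative c (x, y) * v (x, y)) (at x)"
    and diag: "\<And>t. t \<in> I \<Longrightarrow> v (t, t) = n0 t" "\<And>t. t \<in> I \<Longrightarrow> e (t, t) = n1 t"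
      "\<And>t. t \<in> I \<Longrightarrow> l (t, t) = ?n0' t - n1 t" "\<And>t. t \<in> I \<Longrightarrow> m (t, t) = ?n1' t - c (t, t) * n0 t"
    by (rule sol_exists) blast
  have Ce: "Cinf (I \<times> I) e" "Cinf (I \<times> I) l" using Cinf_grad[OF open_square gv] v by auto
  have Cm: "Cinf (I \<times> I) m" using Cinf_grad[OF open_square ge] Ce(1) by auto
  \<comment> \<open>The third frame vector is built from f_y = d v alone; its x-equation is proved
    afterwards.\<close>
  define f where "f p = n2 (fst p) + inty (\<lambda>q. d q * v q) p" for p
  define gx where "gx p = - (k p * c p) * v p + d p * e p" for p
  define fx where "fx p = ?n2' (fst p) + (inty gx p - d (fst p, fst p) * v (fst p, fst p))" for p
  have Cgx: "Cinf (I \<times> I) gx"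
    unfolding gx_def[abs_def] by (intro Cinf_algebra Cinf_mult C v Ce)
  have gdv: "grad_on (I \<times> I) (\<lambda>q. d q * v q) gx (\<lambda>p. dy p * v p + d p * l p)"
    using grad_on_mult[OF gd gv] by (simp add: gx_def[abs_def])
  have "grad_on (I \<times> I) (inty (\<lambda>q. d q * v q))
      (\<lambda>p. inty gx p - d (fst p, fst p) * v (fst p, fst p)) (\<lambda>q. d q * v q)"
    by (rule grad_on_inty[OF Cinf_continuous[OF Cinf_mult[OF C(2) v]] Cinf_continuous[OF Cgx]
          grad_on_real_derivative(1)[OF gdv]])
  from grad_on_add[OF grad_on_fst[of I n2 ?n2', OF d2] this]
  have gf: "grad_on (I \<times> I) f fx (\<lambda>p. d p * v p)"
    unfolding f_def[abs_def] fx_def[abs_def] by simp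
  have fx: "fx (x, y) = - (k (x, y) * e (x, y))" if xy: "x \<in> I" "y \<in> I" for x y
  proof -
    \<comment> \<open>For fixed x the defect f_x + k e is constant in y: (d v)_x = - k c v + d e
      cancels (k e)_y = - d e + k c v. It vanishes on the diagonal by the choice of the
      data.\<close>
    have "fx (x, y) + k (x, y) * e (x, y) = 0"
    proof (rule zero_derivative_zero[where f = "\<lambda>s. fx (x, s) + k (x, s) * e (x, s)" and a = x])
      show "fx (x, x) + k (x, x) * e (x, x) = 0"
        using xy by (simp add: fx_def inty_diag diag)
      fix s assume "s \<in> closed_segment x y"
      then have s: "s \<in> I" using segment_in_I xy by blast
      have "((\<lambda>s. fx (x, s)) has_real_derivative 0 + (gx (x, s) - 0)) (at s)"
        unfolding fx_def fst_conv
        by (intro DERIV_add DERIV_diff DERIV_const inty_deriv Cinf_continuous Cgx xy s)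
      from DERIV_add[OF this DERIV_mult[OF grad_on_real_derivative(2)[OF gk xy(1) s]
            grad_on_real_derivative(2)[OF ge xy(1) s]]]
      show "((\<lambda>s. fx (x, s) + k (x, s) * e (x, s)) has_real_derivative 0) (at s)"
        by (simp add: gx_def algebra_simps)
    qed
    then show ?thesis by linarith
  qed
  have gf': "grad_on (I \<times> I) f (\<lambda>p. - (k p * e p)) (\<lambda>p. d p * v p)"
    by (rule grad_on_cong[OF open_square gf]) (use fx in auto)
  have fdiag: "f (t, t) = n2 t" for t by (simp add: f_def inty_diag)
  have Cf: "continuous_on (I \<times> I) f" by (rule grad_on_continuous[OF gf])
  \<comment> \<open>The defects of e_x = v + k f and v_y = c e + d f. They obey the closed linear
    system z1_y = - z2, z2_x = - c z1 with zero data on the diagonal, so the second defect is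
    carried along to make the first one vanish.\<close>
  define z1 where "z1 p = m p - v p - k p * f p" for p
  define z2 where "z2 p = l p - c p * e p - d p * f p" for p
  have z1: "z1 (x, y) = 0" if xy: "x \<in> I" "y \<in> I" for x y
  proof (rule diagonal_Cauchy_unique(1)[OF I(1,2), of z1 z2 c])
    show "continuous_on (I \<times> I) z1" "continuous_on (I \<times> I) z2"
      unfolding z1_def[abs_def] z2_def[abs_def]
      by (intro continuous_on_diff continuous_on_mult Cf Cinf_continuous Cm v C Ce)+
    show "((\<lambda>s. z1 (x, s)) has_real_derivative - z2 (x, y)) (at y)" if xy: "x \<in> I" "y \<in> I" for x y
      unfolding z1_def
      by (rule DERIV_cong[OF DERIV_diff[OF DERIV_diff[OF my[OF grad_on_mult[OF gc gv] xy]
                grad_on_real_derivative(2)[OF gv xy]]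
              DERIV_mult[OF grad_on_real_derivative(2)[OF gk xy] grad_on_real_derivative(2)[OF gf' xy]]]])
        (simp add: z2_def algebra_simps)
    show "((\<lambda>s. z2 (s, y)) has_real_derivative - (c (x, y) * z1 (x, y))) (at x)"
      if xy: "x \<in> I" "y \<in> I" for x y
      unfolding z2_def
      by (rule DERIV_cong[OF DERIV_diff[OF DERIV_diff[OF lx[OF xy]
                DERIV_mult[OF grad_on_real_derivative(1)[OF gc xy] grad_on_real_derivative(1)[OF ge xy]]]
              DERIV_mult[OF grad_on_real_derivative(1)[OF gd xy] grad_on_real_derivative(1)[OF gf' xy]]]])
        (simp add: z1_def algebra_simps)
    show "z1 (t, t) = 0" "z2 (t, t) = 0" if "t \<in> I" for t
      using that by (simp_all add: z1_def z2_def diag fdiag algebra_simps)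
  qed (use xy C(1) Cinf_continuous in auto)
  have ge': "grad_on (I \<times> I) e (\<lambda>p. v p + k p * f p) (\<lambda>p. c p * v p)"
    by (rule grad_on_cong[OF open_square ge]) (use z1 in \<open>auto simp: z1_def algebra_simps\<close>)
  show ?thesis using that[OF v gv ge' gf' diag(1,2) fdiag] .
qed

text \<open>The x-equations move the frame by a matrix that is skew for the signature (-, +, +), so
  the terms of the derivative cancel identically. The inner products of the frame vectors would
  instead satisfy a coupled linear system and require a further uniqueness argument.\<close>

lemma frame_dual_constant:
  fixes v e f k v' e' f' :: "real \<times> real \<Rightarrow> real"
  assumes "grad_on (I \<times> I) v e l"
    "grad_on (I \<times> I) e (\<lambda>p. v p + k p * f p) ey"
    "grad_on (I \<times> I) f (\<lambda>p. - (k p * e p)) fy"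
    "grad_on (I \<times> I) v' e' l'"
    "grad_on (I \<times> I) e' (\<lambda>p. v' p + k p * f' p) ey'"
    "grad_on (I \<times> I) f' (\<lambda>p. - (k p * e' p)) fy'"
    and xy: "x \<in> I" "y \<in> I"
  shows "- (v (x, y) * v' (x, y)) + e (x, y) * e' (x, y) + f (x, y) * f' (x, y) =
    - (v (y, y) * v' (y, y)) + e (y, y) * e' (y, y) + f (y, y) * f' (y, y)" (is "?P x = ?P y")
proof -
  have "?P x - ?P y = 0"
  proof (rule zero_derivative_zero[where f = "\<lambda>s. ?P s - ?P y" and a = y])
    fix s assume "s \<in> closed_segment y x"
    then have s: "s \<in> I" using segment_in_I xy by blast
    note D = assms(1-6)[THEN grad_on_real_derivative(1), OF s xy(2)]
    show "((\<lambda>s. ?P s - ?P y) has_real_derivative 0) (at s)"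
      by (rule DERIV_cong[OF DERIV_diff[OF DERIV_add[OF DERIV_add[OF DERIV_minus[OF DERIV_mult[OF D(1,4)]]
                DERIV_mult[OF D(2,5)]] DERIV_mult[OF D(3,6)]] DERIV_const]])
        (simp add: algebra_simps)
  qed simp
  then show ?thesis by simp
qed

end

text \<open>A traceless matrix is encoded by \<open>p = X_11 = - X_22\<close>, \<open>q = X_12\<close>, \<open>r = X_21\<close>, so that
  \<open><X, X> = p^2 + q r\<close>. The equivalence is \<open>A B = 1 \<longleftrightarrow> B A = 1\<close> for \<open>3 \<times> 3\<close> matrices.\<close>

lemma orthonormal_iff_complete:
  fixes p0 q0 r0 p1 q1 r1 p2 q2 r2 :: real
  shows "(p0 * p0 + q0 * r0 = - 1 \<and> p1 * p1 + q1 * r1 = 1 \<and> p2 * p2 + q2 * r2 = 1 \<and>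
      2 * p0 * p1 + q0 * r1 + r0 * q1 = 0 \<and> 2 * p0 * p2 + q0 * r2 + r0 * q2 = 0 \<and>
      2 * p1 * p2 + q1 * r2 + r1 * q2 = 0) \<longleftrightarrow>
    (- (p0 * p0) + p1 * p1 + p2 * p2 = 1 \<and> - (p0 * q0) + p1 * q1 + p2 * q2 = 0 \<and>
      - (p0 * r0) + p1 * r1 + p2 * r2 = 0 \<and> - (q0 * q0) + q1 * q1 + q2 * q2 = 0 \<and>
      - (r0 * r0) + r1 * r1 + r2 * r2 = 0 \<and> - (q0 * r0) + q1 * r1 + q2 * r2 = 2)"
proof -
  \<comment> \<open>The rows of \<open>?A\<close> are the three vectors, the first negated for the
    signature; the columns of \<open>?B\<close> are their duals under the inner product. So
    \<open>?A ** ?B\<close> holds the inner products and \<open>?B ** ?A\<close> the entries of the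
    dual tensor.\<close>
  let ?A = "vector [vector [- p0, - q0, - r0], vector [p1, q1, r1], vector [p2, q2, r2]] :: real^3^3"
  let ?B = "vector [vector [p0, p1, p2], vector [r0 / 2, r1 / 2, r2 / 2],
    vector [q0 / 2, q1 / 2, q2 / 2]] :: real^3^3"
  have "?A ** ?B = mat 1 \<longleftrightarrow> ?B ** ?A = mat 1" by (rule matrix_left_right_inverse)
  then show ?thesis
    by (simp add: vec_eq_iff forall_3 matrix_matrix_mult_def sum_3 mat_def field_simps) argo
qed

section \<open>Lorentz harmonic maps\<close>

text \<open>A combination of constant matrices, so that gradients and smoothness of matrix-valued
  maps reduce to the scalar rules.\<close>

definition sl2_mat :: "real \<Rightarrow> real \<Rightarrow> real \<Rightarrow> real^2^2" where
  "sl2_mat p q r = p *\<^sub>R vector [vector [1, 0], vector [0, -1]] + q *\<^sub>R vector [vector [0, 1], vector [0, 0]]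
    + r *\<^sub>R vector [vector [0, 0], vector [1, 0]]"

lemma sl2_mat_entries [simp]:
  "sl2_mat p q r $ 1 $ 1 = p" "sl2_mat p q r $ 1 $ 2 = q"
  "sl2_mat p q r $ 2 $ 1 = r" "sl2_mat p q r $ 2 $ 2 = - p"
  by (simp_all add: sl2_mat_def)

lemma sl2_mat_in_sl2: "sl2_mat p q r \<in> sl2"
  by (simp add: sl2_def trace_def sum_2)

lemma sl2_eq_sl2_mat: "X \<in> sl2 \<Longrightarrow> X = sl2_mat (X $ 1 $ 1) (X $ 1 $ 2) (X $ 2 $ 1)"
  by (simp add: sl2_def trace_def sum_2 vec_eq_iff forall_2 add_eq_0_iff)

lemma sl2_mat_scaleR: "c *\<^sub>R sl2_mat p q r = sl2_mat (c * p) (c * q) (c * r)"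
  by (simp add: vec_eq_iff forall_2)

lemma lor_sl2:
  assumes "X \<in> sl2" "Y \<in> sl2"
  shows "lor X Y = X $ 1 $ 1 * Y $ 1 $ 1 + (X $ 1 $ 2 * Y $ 2 $ 1 + X $ 2 $ 1 * Y $ 1 $ 2) / 2"
proof -
  have "X $ 2 $ 2 = - X $ 1 $ 1" "Y $ 2 $ 2 = - Y $ 1 $ 1"
    using assms by (simp_all add: sl2_def trace_def sum_2 add_eq_0_iff)
  then show ?thesis by (simp add: lor_def det_2 field_simps)
qed

lemma grad_on_sl2_mat:
  assumes "grad_on S p px py" "grad_on S q qx qy" "grad_on S r rx ry"
  shows "grad_on S (\<lambda>a. sl2_mat (p a) (q a) (r a)) (\<lambda>a. sl2_mat (px a) (qx a) (rx a))
    (\<lambda>a. sl2_mat (py a) (qy a) (ry a))"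
  unfolding sl2_mat_def by (intro grad_on_add grad_on_scaleR_const assms)

lemma Cinf_sl2_mat:
  "Cinf S p \<Longrightarrow> Cinf S q \<Longrightarrow> Cinf S r \<Longrightarrow> Cinf S (\<lambda>a. sl2_mat (p a) (q a) (r a))"
  unfolding sl2_mat_def by (intro Cinf_algebra(2) Cinf_scaleR_const)

text \<open>The hypothesis is the resolution of the identity X = - <X, nu> nu + <X, e> e + <X, f> f.
  The numbers \<open>\<alpha>\<close>, \<open>\<beta>\<close>, \<open>\<gamma>\<close> are the three
  inner products of X, the matrix with entries \<open>a\<close>, \<open>b\<close>,
  \<open>c\<close>.\<close>

lemma complete_expansion:
  fixes p0 q0 r0 p1 q1 r1 p2 q2 r2 a b c :: real
  assumes "- (p0 * p0) + p1 * p1 + p2 * p2 = 1 \<and> - (p0 * q0) + p1 * q1 + p2 * q2 = 0 \<and>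
      - (p0 * r0) + p1 * r1 + p2 * r2 = 0 \<and> - (q0 * q0) + q1 * q1 + q2 * q2 = 0 \<and>
      - (r0 * r0) + r1 * r1 + r2 * r2 = 0 \<and> - (q0 * r0) + q1 * r1 + q2 * r2 = 2"
  defines "\<alpha> \<equiv> a * p0 + (b * r0 + c * q0) / 2"
    and "\<beta> \<equiv> a * p1 + (b * r1 + c * q1) / 2"
    and "\<gamma> \<equiv> a * p2 + (b * r2 + c * q2) / 2"
  shows "a = - \<alpha> * p0 + \<beta> * p1 + \<gamma> * p2"
    and "b = - \<alpha> * q0 + \<beta> * q1 + \<gamma> * q2"
    and "c = - \<alpha> * r0 + \<beta> * r1 + \<gamma> * r2"
proof -
  have "- \<alpha> * p0 + \<beta> * p1 + \<gamma> * p2 = a * (- (p0 * p0) + p1 * p1 + p2 * p2)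
      + b / 2 * (- (p0 * r0) + p1 * r1 + p2 * r2) + c / 2 * (- (p0 * q0) + p1 * q1 + p2 * q2)"
    unfolding \<alpha>_def \<beta>_def \<gamma>_def by (simp add: field_simps)
  then show "a = - \<alpha> * p0 + \<beta> * p1 + \<gamma> * p2" using assms(1) by simp
  have "- \<alpha> * q0 + \<beta> * q1 + \<gamma> * q2 = a * (- (p0 * q0) + p1 * q1 + p2 * q2)
      + b / 2 * (- (q0 * r0) + q1 * r1 + q2 * r2) + c / 2 * (- (q0 * q0) + q1 * q1 + q2 * q2)"
    unfolding \<alpha>_def \<beta>_def \<gamma>_def by (simp add: field_simps)
  then show "b = - \<alpha> * q0 + \<beta> * q1 + \<gamma> * q2" using assms(1) by simp
  have "- \<alpha> * r0 + \<beta> * r1 + \<gamma> * r2 = a * (- (p0 * r0) + p1 * r1 + p2 * r2)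
      + b / 2 * (- (r0 * r0) + r1 * r1 + r2 * r2) + c / 2 * (- (q0 * r0) + q1 * r1 + q2 * r2)"
    unfolding \<alpha>_def \<beta>_def \<gamma>_def by (simp add: field_simps)
  then show "c = - \<alpha> * r0 + \<beta> * r1 + \<gamma> * r2" using assms(1) by simp
qed

lemma derivative_of_constant:
  fixes g :: "real \<Rightarrow> real"
  assumes "open I" "\<And>t. t \<in> I \<Longrightarrow> g t = C" "t \<in> I" "(g has_real_derivative g') (at t)"
  shows "g' = 0"
proof -
  have "((\<lambda>_. C) has_real_derivative g') (at t)"
    by (rule has_field_derivative_transform_within_open[OF assms(4,1,3)]) (rule assms(2))
  then show ?thesis using DERIV_unique DERIV_const by blast
qed

text \<open>The three independent matrix entries are solved separately with the same c, d, k. They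
  meet again only in the constraint <nu, nu> = -1.\<close>

theorem mainTheorem2:
  fixes I :: "real set" and N0 N1 :: "real \<Rightarrow> real^2^2"
  assumes "open I" and "is_interval I" and "I \<noteq> {}"
    and "real_analytic_on N0 I" and "real_analytic_on N1 I"
    and "\<forall>t\<in>I. N0 t \<in> H2" and "\<forall>t\<in>I. N1 t \<in> S21"
    and "\<forall>t\<in>I. lor (N1 t) (N0 t) = 0"
    and "\<exists>t\<in>I. lor (N1 t) (vector_derivative N0 (at t) - N1 t) \<noteq> 0"
  shows "\<exists>\<nu>. lorentz_harmonic (I \<times> I) \<nu> \<and>
           (\<forall>t\<in>I. \<nu> (t, t) = N0 t \<and> Dx \<nu> (t, t) = N1 t)"
proof -
  obtain t0 where "t0 \<in> I" using assms(3) by blast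
  then interpret base_interval I t0 using assms(1,2) by unfold_locales
  let ?S = "I \<times> I"
  have sl2: "N0 t \<in> sl2" "N1 t \<in> sl2" if "t \<in> I" for t
    using assms(6,7) that by (auto simp: H2_def S21_def)
  define p0 q0 r0 p1 q1 r1 where "p0 t = N0 t $ 1 $ 1" and "q0 t = N0 t $ 1 $ 2" and "r0 t = N0 t $ 2 $ 1"
    and "p1 t = N1 t $ 1 $ 1" and "q1 t = N1 t $ 1 $ 2" and "r1 t = N1 t $ 2 $ 1" for t
  note entries = p0_def q0_def r0_def p1_def q1_def r1_def
  \<comment> \<open>The entries of the cross product \<open>[N0, N1] / 2\<close>.\<close>
  define p2 q2 r2 where "p2 t = (q0 t * r1 t - r0 t * q1 t) / 2"
    and "q2 t = p0 t * q1 t - q0 t * p1 t" and "r2 t = r0 t * p1 t - p0 t * r1 t" for t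
  have N: "N0 t = sl2_mat (p0 t) (q0 t) (r0 t)" "N1 t = sl2_mat (p1 t) (q1 t) (r1 t)" if "t \<in> I" for t
    using sl2_eq_sl2_mat[OF sl2(1)[OF that]] sl2_eq_sl2_mat[OF sl2(2)[OF that]] by (simp_all add: entries)
  have on0: "p0 t * p0 t + q0 t * r0 t = - 1" and on1: "p1 t * p1 t + q1 t * r1 t = 1"
    and on01: "2 * p0 t * p1 t + q0 t * r1 t + r0 t * q1 t = 0" if "t \<in> I" for t
  proof -
    have "lor (N0 t) (N0 t) = -1" "lor (N1 t) (N1 t) = 1" "lor (N1 t) (N0 t) = 0"
      using assms(6-8) that by (auto simp: H2_def S21_def)
    then show "p0 t * p0 t + q0 t * r0 t = - 1" "p1 t * p1 t + q1 t * r1 t = 1"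
      "2 * p0 t * p1 t + q0 t * r1 t + r0 t * q1 t = 0"
      using sl2[OF that] by (simp_all add: lor_sl2 entries field_simps)
  qed
  have on02: "2 * p0 t * p2 t + q0 t * r2 t + r0 t * q2 t = 0"
    and on12: "2 * p1 t * p2 t + q1 t * r2 t + r1 t * q2 t = 0" for t
    by (simp_all add: p2_def q2_def r2_def field_simps)
  have on2: "p2 t * p2 t + q2 t * r2 t = 1" if "t \<in> I" for t
  proof -
    \<comment> \<open>Lagrange identity in signature (2,1): <f, f> = <N0, N1>^2 - <N0, N0> <N1,
      N1>.\<close>
    have "p2 t * p2 t + q2 t * r2 t = ((2 * p0 t * p1 t + q0 t * r1 t + r0 t * q1 t) / 2)\<^sup>2
        - (p0 t * p0 t + q0 t * r0 t) * (p1 t * p1 t + q1 t * r1 t)"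
      by (simp add: p2_def q2_def r2_def power2_eq_square field_simps)
    then show ?thesis by (simp add: on0 on1 on01 that)
  qed
  have complete: "- (p0 t * p0 t) + p1 t * p1 t + p2 t * p2 t = 1 \<and> - (p0 t * q0 t) + p1 t * q1 t + p2 t * q2 t = 0 \<and>
      - (p0 t * r0 t) + p1 t * r1 t + p2 t * r2 t = 0 \<and> - (q0 t * q0 t) + q1 t * q1 t + q2 t * q2 t = 0 \<and>
      - (r0 t * r0 t) + r1 t * r1 t + r2 t * r2 t = 0 \<and> - (q0 t * r0 t) + q1 t * r1 t + q2 t * r2 t = 2"
    if "t \<in> I" for t
    using on0[OF that] on1[OF that] on2[OF that] on01[OF that] on02 on12
    by (intro orthonormal_iff_complete[THEN iffD1] conjI)
  have an: "real_analytic_on p0 I" "real_analytic_on q0 I" "real_analytic_on r0 I"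
    "real_analytic_on p1 I" "real_analytic_on q1 I" "real_analytic_on r1 I"
    unfolding entries[abs_def] using assms(4,5) by (auto intro: real_analytic_on_entry)
  note C01 = an[THEN real_analytic_on_Cinf]
  have C2: "Cinf ?S (\<lambda>p. p2 (fst p))" "Cinf ?S (\<lambda>p. q2 (fst p))" "Cinf ?S (\<lambda>p. r2 (fst p))"
    unfolding p2_def q2_def r2_def divide_inverse by (intro Cinf_algebra Cinf_mult C01)+
  note D = an[THEN real_analytic_on_deriv(1)] C2[THEN Cinf_fst_deriv]
  note Cd = an(1-3)[THEN real_analytic_on_deriv(2), THEN real_analytic_on_Cinf]
    an(4-6)[THEN real_analytic_on_deriv(2), THEN real_analytic_on_Cinf]
  \<comment> \<open>These are <N0', N1> - 1, <N0', f> and <N1', f>, read off from N0' = (1 + c) N1 +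
    d f and N1' = (1 + c) N0 + k f. The -1 removes the contribution of nu_x = e to the derivative
    along the diagonal.\<close>
  define c0 d0 k0 where "c0 t = deriv p0 t * p1 t + (deriv q0 t * r1 t + deriv r0 t * q1 t) / 2 - 1"
    and "d0 t = deriv p0 t * p2 t + (deriv q0 t * r2 t + deriv r0 t * q2 t) / 2"
    and "k0 t = deriv p1 t * p2 t + (deriv q1 t * r2 t + deriv r1 t * q2 t) / 2" for t
  have "Cinf ?S (\<lambda>p. c0 (fst p))" "Cinf ?S (\<lambda>p. d0 (fst p))" "Cinf ?S (\<lambda>p. k0 (fst p))"
    unfolding c0_def d0_def k0_def divide_inverse by (intro Cinf_algebra Cinf_mult C01 C2 Cd)+
  then obtain c d k cy dy kx where cdk: "Cinf ?S c" "Cinf ?S d" "Cinf ?S k"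
    "grad_on ?S c (\<lambda>p. k p * d p) cy" "grad_on ?S d (\<lambda>p. - (k p * c p)) dy"
    "grad_on ?S k kx (\<lambda>p. - d p)"
    and cdk0: "\<And>t. t \<in> I \<Longrightarrow> c (t, t) = c0 t" "\<And>t. t \<in> I \<Longrightarrow> d (t, t) = d0 t"
      "\<And>t. t \<in> I \<Longrightarrow> k (t, t) = k0 t"
    by (rule structure_equations_exist) blast
  \<comment> \<open>Frenet-type equations of the initial frame: each derivative is expanded in the
    frame, and orthonormality leaves only \<open>c0\<close>, \<open>d0\<close>, \<open>k0\<close> as
    free coefficients.\<close>
  have E: "deriv p0 t = (1 + c0 t) * p1 t + d0 t * p2 t" "deriv q0 t = (1 + c0 t) * q1 t + d0 t * q2 t"
    "deriv r0 t = (1 + c0 t) * r1 t + d0 t * r2 t"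
    "deriv p1 t = (1 + c0 t) * p0 t + k0 t * p2 t" "deriv q1 t = (1 + c0 t) * q0 t + k0 t * q2 t"
    "deriv r1 t = (1 + c0 t) * r0 t + k0 t * r2 t"
    "deriv p2 t = d0 t * p0 t - k0 t * p1 t" "deriv q2 t = d0 t * q0 t - k0 t * q1 t"
    "deriv r2 t = d0 t * r0 t - k0 t * r1 t" if t: "t \<in> I" for t
  proof -
    note Dt = D[OF t]
    note zero = derivative_of_constant[OF assms(1) _ t]
    \<comment> \<open>A vector of constant length is orthogonal to its derivative.\<close>
    have same: "deriv p t * p t + (deriv q t * r t + deriv r t * q t) / 2 = 0"
      if "\<And>t. t \<in> I \<Longrightarrow> p t * p t + q t * r t = C"
        and d: "(p has_real_derivative deriv p t) (at t)" "(q has_real_derivative deriv q t) (at t)"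
          "(r has_real_derivative deriv r t) (at t)" for p q r C
      using zero[OF that(1) DERIV_add[OF DERIV_mult[OF d(1,1)] DERIV_mult[OF d(2,3)]]]
      by (simp add: field_simps)
    \<comment> \<open>For orthogonal vector functions X and Y, <Y', X> = - <X', Y>.\<close>
    have mixed: "deriv p' t * p t + (deriv q' t * r t + deriv r' t * q t) / 2 =
        - (deriv p t * p' t + (deriv q t * r' t + deriv r t * q' t) / 2)"
      if "\<And>t. t \<in> I \<Longrightarrow> 2 * p t * p' t + q t * r' t + r t * q' t = 0"
        and d: "(p has_real_derivative deriv p t) (at t)" "(q has_real_derivative deriv q t) (at t)"
          "(r has_real_derivative deriv r t) (at t)" "(p' has_real_derivative deriv p' t) (at t)"
          "(q' has_real_derivative deriv q' t) (at t)" "(r' has_real_derivative deriv r' t) (at t)"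
        for p q r p' q' r'
      using zero[OF that(1) DERIV_add[OF DERIV_add[OF DERIV_mult[OF DERIV_cmult[OF d(1), of 2] d(4)]
            DERIV_mult[OF d(2,6)]] DERIV_mult[OF d(3,5)]]]
      by (simp add: field_simps)
    have s0: "deriv p0 t * p0 t + (deriv q0 t * r0 t + deriv r0 t * q0 t) / 2 = 0"
      by (rule same[OF _ Dt(1-3)]) (rule on0)
    have s1: "deriv p1 t * p1 t + (deriv q1 t * r1 t + deriv r1 t * q1 t) / 2 = 0"
      by (rule same[OF _ Dt(4-6)]) (rule on1)
    have s2: "deriv p2 t * p2 t + (deriv q2 t * r2 t + deriv r2 t * q2 t) / 2 = 0"
      by (rule same[OF _ Dt(7-9)]) (rule on2)
    have m01: "deriv p1 t * p0 t + (deriv q1 t * r0 t + deriv r1 t * q0 t) / 2 =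
        - (deriv p0 t * p1 t + (deriv q0 t * r1 t + deriv r0 t * q1 t) / 2)"
      by (rule mixed[OF _ Dt(1-3,4-6)]) (rule on01)
    have m02: "deriv p2 t * p0 t + (deriv q2 t * r0 t + deriv r2 t * q0 t) / 2 =
        - (deriv p0 t * p2 t + (deriv q0 t * r2 t + deriv r0 t * q2 t) / 2)"
      by (rule mixed[OF _ Dt(1-3,7-9)]) (rule on02)
    have m12: "deriv p2 t * p1 t + (deriv q2 t * r1 t + deriv r2 t * q1 t) / 2 =
        - (deriv p1 t * p2 t + (deriv q1 t * r2 t + deriv r1 t * q2 t) / 2)"
      by (rule mixed[OF _ Dt(4-6,7-9)]) (rule on12)
    note exp0 = complete_expansion[where a = "deriv p0 t" and b = "deriv q0 t" and c = "deriv r0 t",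
        OF complete[OF t]]
    note exp1 = complete_expansion[where a = "deriv p1 t" and b = "deriv q1 t" and c = "deriv r1 t",
        OF complete[OF t]]
    note exp2 = complete_expansion[where a = "deriv p2 t" and b = "deriv q2 t" and c = "deriv r2 t",
        OF complete[OF t]]
    have c: "deriv p0 t * p1 t + (deriv q0 t * r1 t + deriv r0 t * q1 t) / 2 = 1 + c0 t"
      by (simp add: c0_def)
    show "deriv p0 t = (1 + c0 t) * p1 t + d0 t * p2 t" "deriv q0 t = (1 + c0 t) * q1 t + d0 t * q2 t"
      "deriv r0 t = (1 + c0 t) * r1 t + d0 t * r2 t"
      using exp0 unfolding s0 c d0_def[symmetric] by simp_all
    show "deriv p1 t = (1 + c0 t) * p0 t + k0 t * p2 t" "deriv q1 t = (1 + c0 t) * q0 t + k0 t * q2 t"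
      "deriv r1 t = (1 + c0 t) * r0 t + k0 t * r2 t"
      using exp1 unfolding s1 m01 c k0_def[symmetric] by simp_all
    show "deriv p2 t = d0 t * p0 t - k0 t * p1 t" "deriv q2 t = d0 t * q0 t - k0 t * q1 t"
      "deriv r2 t = d0 t * r0 t - k0 t * r1 t"
      using exp2 unfolding s2 m02 m12 d0_def[symmetric] k0_def[symmetric] by simp_all
  qed
  have D': "\<And>t. t \<in> I \<Longrightarrow> (p0 has_real_derivative (1 + c (t, t)) * p1 t + d (t, t) * p2 t) (at t)"
    "\<And>t. t \<in> I \<Longrightarrow> (q0 has_real_derivative (1 + c (t, t)) * q1 t + d (t, t) * q2 t) (at t)"
    "\<And>t. t \<in> I \<Longrightarrow> (r0 has_real_derivative (1 + c (t, t)) * r1 t + d (t, t) * r2 t) (at t)"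
    "\<And>t. t \<in> I \<Longrightarrow> (p1 has_real_derivative (1 + c (t, t)) * p0 t + k (t, t) * p2 t) (at t)"
    "\<And>t. t \<in> I \<Longrightarrow> (q1 has_real_derivative (1 + c (t, t)) * q0 t + k (t, t) * q2 t) (at t)"
    "\<And>t. t \<in> I \<Longrightarrow> (r1 has_real_derivative (1 + c (t, t)) * r0 t + k (t, t) * r2 t) (at t)"
    "\<And>t. t \<in> I \<Longrightarrow> (p2 has_real_derivative d (t, t) * p0 t - k (t, t) * p1 t) (at t)"
    "\<And>t. t \<in> I \<Longrightarrow> (q2 has_real_derivative d (t, t) * q0 t - k (t, t) * q1 t) (at t)"
    "\<And>t. t \<in> I \<Longrightarrow> (r2 has_real_derivative d (t, t) * r0 t - k (t, t) * r1 t) (at t)"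
    by (rule DERIV_cong, erule D, simp add: E cdk0)+
  obtain vp ep fp lp where p: "Cinf ?S vp" "grad_on ?S vp ep lp"
    "grad_on ?S ep (\<lambda>a. vp a + k a * fp a) (\<lambda>a. c a * vp a)"
    "grad_on ?S fp (\<lambda>a. - (k a * ep a)) (\<lambda>a. d a * vp a)"
    "\<And>t. t \<in> I \<Longrightarrow> vp (t, t) = p0 t" "\<And>t. t \<in> I \<Longrightarrow> ep (t, t) = p1 t" "\<And>t. t \<in> I \<Longrightarrow> fp (t, t) = p2 t"
    by (rule frame_component_exists[OF cdk C01(1,4) D'(1,4,7)]) blast+
  obtain vq eq fq lq where q: "Cinf ?S vq" "grad_on ?S vq eq lq"
    "grad_on ?S eq (\<lambda>a. vq a + k a * fq a) (\<lambda>a. c a * vq a)"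
    "grad_on ?S fq (\<lambda>a. - (k a * eq a)) (\<lambda>a. d a * vq a)"
    "\<And>t. t \<in> I \<Longrightarrow> vq (t, t) = q0 t" "\<And>t. t \<in> I \<Longrightarrow> eq (t, t) = q1 t" "\<And>t. t \<in> I \<Longrightarrow> fq (t, t) = q2 t"
    by (rule frame_component_exists[OF cdk C01(2,5) D'(2,5,8)]) blast+
  obtain vr er fr lr where r: "Cinf ?S vr" "grad_on ?S vr er lr"
    "grad_on ?S er (\<lambda>a. vr a + k a * fr a) (\<lambda>a. c a * vr a)"
    "grad_on ?S fr (\<lambda>a. - (k a * er a)) (\<lambda>a. d a * vr a)"
    "\<And>t. t \<in> I \<Longrightarrow> vr (t, t) = r0 t" "\<And>t. t \<in> I \<Longrightarrow> er (t, t) = r1 t" "\<And>t. t \<in> I \<Longrightarrow> fr (t, t) = r2 t"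
    by (rule frame_component_exists[OF cdk C01(3,6) D'(3,6,9)]) blast+
  \<comment> \<open>The six entries of the dual tensor are carried from (y, y), where the initial
    frame is complete, to (x, y). Going back from completeness to orthonormality then yields <nu,
    nu> = -1.\<close>
  have norm: "vp a * vp a + vq a * vr a = - 1" if aS: "a \<in> ?S" for a
  proof -
    obtain x y where a: "a = (x, y)" and xy: "x \<in> I" "y \<in> I" using aS by auto
    note const = frame_dual_constant[OF p(2-4) p(2-4) xy] frame_dual_constant[OF p(2-4) q(2-4) xy]
      frame_dual_constant[OF p(2-4) r(2-4) xy] frame_dual_constant[OF q(2-4) q(2-4) xy]
      frame_dual_constant[OF r(2-4) r(2-4) xy] frame_dual_constant[OF q(2-4) r(2-4) xy]
    note orthonormal_iff_complete[of "vp a" "vq a" "vr a" "ep a" "eq a" "er a" "fp a" "fq a" "fr a"]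
    then show ?thesis
      using complete[OF xy(2)] const by (simp add: a p(5-7) q(5-7) r(5-7) xy)
  qed
  define \<nu> where "\<nu> a = sl2_mat (vp a) (vq a) (vr a)" for a
  have g: "grad_on ?S \<nu> (\<lambda>a. sl2_mat (ep a) (eq a) (er a)) (\<lambda>a. sl2_mat (lp a) (lq a) (lr a))"
    unfolding \<nu>_def[abs_def] by (rule grad_on_sl2_mat[OF p(2) q(2) r(2)])
  note Dx = grad_on_Dx_Dy(1)[OF g]
  have gx: "grad_on ?S (Dx \<nu>)
      (\<lambda>a. sl2_mat (vp a + k a * fp a) (vq a + k a * fq a) (vr a + k a * fr a)) (\<lambda>a. c a *\<^sub>R \<nu> a)"
    by (rule grad_on_cong[OF open_square grad_on_sl2_mat[OF p(3) q(3) r(3)]])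
      (auto simp: Dx \<nu>_def sl2_mat_scaleR)
  have "smooth2_on ?S \<nu>"
    unfolding \<nu>_def[abs_def] by (intro Cinf_smooth2_on open_square Cinf_sl2_mat p(1) q(1) r(1))
  moreover have "\<nu> a \<in> H2" if "a \<in> ?S" for a
    using norm[OF that] by (simp add: H2_def \<nu>_def sl2_mat_in_sl2 lor_sl2)
  moreover have "\<exists>s. Dy (Dx \<nu>) a = s *\<^sub>R \<nu> a" if "a \<in> ?S" for a
    using grad_on_Dx_Dy(2)[OF gx that] by blast
  ultimately have "lorentz_harmonic ?S \<nu>"
    unfolding lorentz_harmonic_def by blast
  moreover have "\<nu> (t, t) = N0 t \<and> Dx \<nu> (t, t) = N1 t" if "t \<in> I" for t
    using that by (simp add: Dx N p(5,6) q(5,6) r(5,6)) (simp add: \<nu>_def p(5) q(5) r(5))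
  ultimately show ?thesis by blast
qed

end
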